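(* Consider the problem SSASP: minimize $\sum_{k=1}^N(\pi_k+\gamma_k)$ over $\boldsymbol\pi,\boldsymbol\gamma\in\{0,1\}^N$, $\boldsymbol N\in\mathbb R^{n_u\times n_y}$, $\boldsymbol M\in\mathbb R^{n_u\times n_u}$ and symmetric $\boldsymbol P\in\mathbb R^{n_x\times n_x}$ subject to $$\boldsymbol A^\top \boldsymbol P+\boldsymbol P\boldsymbol A+\boldsymbol C^\top\boldsymbol\Gamma \boldsymbol N^\top\boldsymbol\Pi \boldsymbol B^\top+\boldsymbol B\boldsymbol\Pi \boldsymbol N\boldsymbol\Gamma \boldsymbol C\prec0,\quad \boldsymbol B\boldsymbol\Pi \boldsymbol M=\boldsymbol P\boldsymbol B\boldsymbol\Pi,\quad \boldsymbol P\succ0,\quad \boldsymbol\Phi\begin{bmatrix}\boldsymbol\pi\\ \boldsymbol\gamma\end{bmatrix}\le\boldsymbol\phi .$$ Then SSASP is equivalent to the following problem: minimize $\sum_{k=1}^N(\pi_k+\gamma_k)$ over $\boldsymbol\pi,\boldsymbol\gamma\in\{0,1\}^N$, $\boldsymbol N\in\mathbb R^{n_u\times n_y}$, $\boldsymbol M\in\mathbb R^{n_u\times n_u}$, symmetric $\boldsymbol P\in\mathbb R^{n_x\times n_x}$ and $\boldsymbol\Theta\in\mathbb R^{n_u\times n_y}$ subject to $$\boldsymbol A^\top \boldsymbol P+\boldsymbol P\boldsymbol A+\boldsymbol C^\top\boldsymbol\Theta^\top \boldsymbol B^\top+\boldsymbol B\boldsymbol\Theta \boldsymbol C\prec0,$$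 $$\boldsymbol\Psi_1(\boldsymbol N,\boldsymbol\Theta)\le L_1\boldsymbol\Delta_1(\boldsymbol\Gamma,\boldsymbol\Pi),\quad \boldsymbol\Psi_2(\boldsymbol M,\boldsymbol\Omega(\boldsymbol P))\le L_2\boldsymbol\Delta_2(\boldsymbol\Pi),\quad \boldsymbol\Psi_3(\boldsymbol\Xi(\boldsymbol P))\le L_3\boldsymbol\Delta_3(\boldsymbol\Pi),$$ $$\boldsymbol P\succ 0,\quad \boldsymbol\Phi\begin{bmatrix}\boldsymbol\pi\\ \boldsymbol\gamma\end{bmatrix}\le\boldsymbol\phi,$$ where vector inequalities are entrywise, the functions $\boldsymbol\Psi_i,\boldsymbol\Delta_i,\boldsymbol\Omega,\boldsymbol\Xi$ are those defined in the context (so that the three constraints involving $\boldsymbol\Psi_1,\boldsymbol\Psi_2,\boldsymbol\Psi_3$ are linear), $\boldsymbol\Theta$ is an additional optimization variable, and $L_1,L_2,L_3>0$ are predefined, sufficiently large constants.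
   Context: Setting: a linear network $\dot{\boldsymbol x}=\boldsymbol A\boldsymbol x+\boldsymbol B\boldsymbol u$, $\boldsymbol y=\boldsymbol C\boldsymbol x$ with $N$ nodes. Node $i$ has state, input and output dimensions $n_{x_i},n_{u_i},n_{y_i}$, with totals $n_x,n_u,n_y$. $\boldsymbol A\in\mathbb R^{n_x\times n_x}$; $\boldsymbol B=\mathrm{Blkdiag}(\boldsymbol B_1,\dots,\boldsymbol B_N)\in\mathbb R^{n_x\times n_u}$ and $\boldsymbol C=\mathrm{Blkdiag}(\boldsymbol C_1,\dots,\boldsymbol C_N)\in\mathbb R^{n_y\times n_x}$ with $\boldsymbol B_i\in\mathbb R^{n_{x_i}\times n_{u_i}}$, $\boldsymbol C_i\in\mathbb R^{n_{y_i}\times n_{x_i}}$. Standing assumptions: $(\boldsymbol A,\boldsymbol B)$ is stabilizable, $(\boldsymbol A,\boldsymbol C)$ is detectable, $\boldsymbol B$ has full column rank and $\boldsymbol C$ has full row rank. $\boldsymbol\Phi$, $\boldsymbol\phi$ are a given real matrix (with $2N$ columns) and a given real vector of compatible size. For $\boldsymbol\pi,\boldsymbol\gamma\in\{0,1\}^N$ (actuator and sensor selections): $\boldsymbol\Pi=\mathrm{Blkdiag}(\pi_1\boldsymbol I_{n_{u_1}},\dots,\pi_N\boldsymbol I_{n_{u_N}})$ and $\boldsymbol\Gamma=\mathrm{Blkdiag}(\gamma_1\boldsymbol I_{n_{y_1}},\dots,\gamma_N\boldsymbol I_{n_{y_N}})$. $\mathrm{Vec}(\boldsymbol X)$ stacks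 the columns of $\boldsymbol X$ into a vector, $\mathrm{Diag}(\boldsymbol Y)$ is the column vector of diagonal entries of a square matrix $\boldsymbol Y$, and $\otimes$ is the Kronecker product. Definitions of the functions: $$\boldsymbol\Omega(\boldsymbol P)=(\boldsymbol B^\top \boldsymbol B)^{-1}\boldsymbol B^\top \boldsymbol P\boldsymbol B,\qquad \boldsymbol\Xi(\boldsymbol P)=(\boldsymbol I-\boldsymbol B(\boldsymbol B^\top \boldsymbol B)^{-1}\boldsymbol B^\top)\boldsymbol P\boldsymbol B,$$ $$\boldsymbol\Psi_1(\boldsymbol N,\boldsymbol\Theta)=\begin{bmatrix}\mathrm{Vec}(\boldsymbol\Theta)\\-\mathrm{Vec}(\boldsymbol\Theta)\\ \mathrm{Vec}(\boldsymbol\Theta)\\-\mathrm{Vec}(\boldsymbol\Theta)\\ \mathrm{Vec}(\boldsymbol\Theta-\boldsymbol N)\\-\mathrm{Vec}(\boldsymbol\Theta-\boldsymbol N)\end{bmatrix},\quad \boldsymbol\Delta_1(\boldsymbol\Gamma,\boldsymbol\Pi)=\begin{bmatrix}\mathrm{Diag}(\boldsymbol I_{n_y}\otimes\boldsymbol\Pi)\\ \mathrm{Diag}(\boldsymbol I_{n_y}\otimes\boldsymbol\Pi)\\ \mathrm{Diag}(\boldsymbol\Gamma\otimes \boldsymbol I_{n_u})\\ \mathrm{Diag}(\boldsymbol\Gamma\otimes \boldsymbol I_{n_u})\\ \mathrm{Diag}(2\boldsymbol I_{n_un_y}-\boldsymbol I_{n_y}\otimes\boldsymbol\Pi-\boldsymbol\Gamma\otimes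 \boldsymbol I_{n_u})\\ \mathrm{Diag}(2\boldsymbol I_{n_un_y}-\boldsymbol I_{n_y}\otimes\boldsymbol\Pi-\boldsymbol\Gamma\otimes \boldsymbol I_{n_u})\end{bmatrix},$$ $$\boldsymbol\Psi_2(\boldsymbol M,\boldsymbol\Omega(\boldsymbol P))=\begin{bmatrix}\mathrm{Vec}(\boldsymbol M)\\-\mathrm{Vec}(\boldsymbol M)\\ \mathrm{Vec}(\boldsymbol\Omega(\boldsymbol P))\\-\mathrm{Vec}(\boldsymbol\Omega(\boldsymbol P))\\ \mathrm{Vec}(\boldsymbol M-\boldsymbol\Omega(\boldsymbol P))\\-\mathrm{Vec}(\boldsymbol M-\boldsymbol\Omega(\boldsymbol P))\end{bmatrix},\quad \boldsymbol\Delta_2(\boldsymbol\Pi)=\begin{bmatrix}\mathrm{Diag}(\boldsymbol I_{n_u^2}-\boldsymbol I_{n_u}\otimes\boldsymbol\Pi+\boldsymbol\Pi\otimes \boldsymbol I_{n_u})\\ \mathrm{Diag}(\boldsymbol I_{n_u^2}-\boldsymbol I_{n_u}\otimes\boldsymbol\Pi+\boldsymbol\Pi\otimes \boldsymbol I_{n_u})\\ \mathrm{Diag}(\boldsymbol I_{n_u^2}+\boldsymbol I_{n_u}\otimes\boldsymbol\Pi-\boldsymbol\Pi\otimes \boldsymbol I_{n_u})\\ \mathrm{Diag}(\boldsymbol I_{n_u^2}+\boldsymbol I_{n_u}\otimes\boldsymbol\Pi-\boldsymbol\Pi\otimes \boldsymbol I_{n_u})\\ \mathrm{Diag}(2\boldsymbol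 I_{n_u^2}-\boldsymbol I_{n_u}\otimes\boldsymbol\Pi-\boldsymbol\Pi\otimes \boldsymbol I_{n_u})\\ \mathrm{Diag}(2\boldsymbol I_{n_u^2}-\boldsymbol I_{n_u}\otimes\boldsymbol\Pi-\boldsymbol\Pi\otimes \boldsymbol I_{n_u})\end{bmatrix},$$ $$\boldsymbol\Psi_3(\boldsymbol\Xi(\boldsymbol P))=\begin{bmatrix}\mathrm{Vec}(\boldsymbol\Xi(\boldsymbol P))\\-\mathrm{Vec}(\boldsymbol\Xi(\boldsymbol P))\end{bmatrix},\quad \boldsymbol\Delta_3(\boldsymbol\Pi)=\begin{bmatrix}\mathrm{Diag}(\boldsymbol I_{n_xn_u}-\boldsymbol\Pi\otimes \boldsymbol I_{n_x})\\ \mathrm{Diag}(\boldsymbol I_{n_xn_u}-\boldsymbol\Pi\otimes \boldsymbol I_{n_x})\end{bmatrix}.$$ *)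

theory Defs
  imports
    "Jordan_Normal_Form.Char_Poly"
    "Jordan_Normal_Form.DL_Rank"
    "Jordan_Normal_Form.Gauss_Jordan_Elimination"
    "HOL-Library.Extended_Real"
begin

definition pos_def :: "real mat \<Rightarrow> bool" where
  "pos_def X \<longleftrightarrow> X\<^sup>T = X \<and>
     (\<forall>v \<in> carrier_vec (dim_row X). v \<noteq> 0\<^sub>v (dim_row X) \<longrightarrow> v \<bullet> (X *\<^sub>v v) > 0)"

definition neg_def :: "real mat \<Rightarrow> bool" where
  "neg_def X \<longleftrightarrow> X\<^sup>T = X \<and>
     (\<forall>v \<in> carrier_vec (dim_row X). v \<noteq> 0\<^sub>v (dim_row X) \<longrightarrow> v \<bullet> (X *\<^sub>v v) < 0)"

definition hurwitz :: "real mat \<Rightarrow> bool" where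
  "hurwitz X \<longleftrightarrow> (\<forall>z. eigenvalue (map_mat complex_of_real X) z \<longrightarrow> Re z < 0)"

definition stabilizable :: "real mat \<Rightarrow> real mat \<Rightarrow> bool" where
  "stabilizable A B \<longleftrightarrow> (\<exists>K \<in> carrier_mat (dim_col B) (dim_row A). hurwitz (A + B * K))"

definition detectable :: "real mat \<Rightarrow> real mat \<Rightarrow> bool" where
  "detectable A C \<longleftrightarrow> (\<exists>K \<in> carrier_mat (dim_row A) (dim_row C). hurwitz (A + K * C))"

text \<open>In both rank conditions the rank is the dimension of the column space, a subspace of the
  space whose dimension is the number of rows.\<close>

definition full_col_rank :: "real mat \<Rightarrow> bool" where
  "full_col_rank X \<longleftrightarrow> vec_space.rank (dim_row X) X = dim_col X"

definition full_row_rank :: "real mat \<Rightarrow> bool" where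
  "full_row_rank X \<longleftrightarrow> vec_space.rank (dim_row X) X = dim_row X"

definition kronecker :: "real mat \<Rightarrow> real mat \<Rightarrow> real mat" (infixl \<open>\<otimes>\<^sub>k\<close> 70) where
  "X \<otimes>\<^sub>k Y = mat (dim_row X * dim_row Y) (dim_col X * dim_col Y)
     (\<lambda>(i, j). X $$ (i div dim_row Y, j div dim_col Y) * Y $$ (i mod dim_row Y, j mod dim_col Y))"

text \<open>Column stacking: entry \<open>(i, j)\<close> of \<open>X\<close> goes to position \<open>j * dim_row X + i\<close>.\<close>

definition Vec :: "real mat \<Rightarrow> real vec" where
  "Vec X = vec (dim_row X * dim_col X) (\<lambda>k. X $$ (k mod dim_row X, k div dim_row X))"

definition Diag :: "real mat \<Rightarrow> real vec" where
  "Diag X = vec_of_list (diag_mat X)"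

definition binary_vec :: "nat \<Rightarrow> real vec \<Rightarrow> bool" where
  "binary_vec n s \<longleftrightarrow> s \<in> carrier_vec n \<and> (\<forall>i<n. s $ i \<in> {0, 1})"

text \<open>The block-diagonal matrix with blocks \<open>s\<^sub>i I\<close>, the \<open>i\<close>-th identity having size \<open>d i\<close>.\<close>

definition selection_mat :: "(nat \<Rightarrow> nat) \<Rightarrow> real vec \<Rightarrow> real mat" where
  "selection_mat d s = diag_block_mat (map (\<lambda>i. s $ i \<cdot>\<^sub>m 1\<^sub>m (d i)) [0..<dim_vec s])"

text \<open>\<open>the (mat_inverse X)\<close> is the inverse of \<open>X\<close> whenever \<open>X\<close> is invertible; below it is applied to
  \<open>B\<^sup>T * B\<close>, which is invertible for \<open>B\<close> of full column rank.\<close>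

definition Omega :: "real mat \<Rightarrow> real mat \<Rightarrow> real mat" where
  "Omega B P = the (mat_inverse (B\<^sup>T * B)) * B\<^sup>T * P * B"

definition Xi :: "real mat \<Rightarrow> real mat \<Rightarrow> real mat" where
  "Xi B P = (1\<^sub>m (dim_row B) - B * the (mat_inverse (B\<^sup>T * B)) * B\<^sup>T) * P * B"

definition Psi1 :: "real mat \<Rightarrow> real mat \<Rightarrow> real vec" where
  "Psi1 N \<Theta> = Vec \<Theta> @\<^sub>v - Vec \<Theta> @\<^sub>v Vec \<Theta> @\<^sub>v - Vec \<Theta> @\<^sub>v Vec (\<Theta> - N) @\<^sub>v - Vec (\<Theta> - N)"

text \<open>The sizes \<open>n\<^sub>u\<close> and \<open>n\<^sub>y\<close> are those of the (square) selection matrices; \<open>G\<close> is the sensor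
  selection matrix and \<open>S\<close> the actuator selection matrix.\<close>

definition Delta1 :: "real mat \<Rightarrow> real mat \<Rightarrow> real vec" where
  "Delta1 G S = (let ny = dim_row G; nu = dim_row S;
       a = Diag (1\<^sub>m ny \<otimes>\<^sub>k S);
       b = Diag (G \<otimes>\<^sub>k 1\<^sub>m nu);
       c = Diag (2 \<cdot>\<^sub>m 1\<^sub>m (nu * ny) - 1\<^sub>m ny \<otimes>\<^sub>k S - G \<otimes>\<^sub>k 1\<^sub>m nu)
     in a @\<^sub>v a @\<^sub>v b @\<^sub>v b @\<^sub>v c @\<^sub>v c)"

definition Psi2 :: "real mat \<Rightarrow> real mat \<Rightarrow> real vec" where
  "Psi2 M W = Vec M @\<^sub>v - Vec M @\<^sub>v Vec W @\<^sub>v - Vec W @\<^sub>v Vec (M - W) @\<^sub>v - Vec (M - W)"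

definition Delta2 :: "real mat \<Rightarrow> real vec" where
  "Delta2 S = (let nu = dim_row S;
       a = Diag (1\<^sub>m (nu\<^sup>2) - 1\<^sub>m nu \<otimes>\<^sub>k S + S \<otimes>\<^sub>k 1\<^sub>m nu);
       b = Diag (1\<^sub>m (nu\<^sup>2) + 1\<^sub>m nu \<otimes>\<^sub>k S - S \<otimes>\<^sub>k 1\<^sub>m nu);
       c = Diag (2 \<cdot>\<^sub>m 1\<^sub>m (nu\<^sup>2) - 1\<^sub>m nu \<otimes>\<^sub>k S - S \<otimes>\<^sub>k 1\<^sub>m nu)
     in a @\<^sub>v a @\<^sub>v b @\<^sub>v b @\<^sub>v c @\<^sub>v c)"

definition Psi3 :: "real mat \<Rightarrow> real vec" where
  "Psi3 X = Vec X @\<^sub>v - Vec X"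

definition Delta3 :: "nat \<Rightarrow> real mat \<Rightarrow> real vec" where
  "Delta3 nx S = (let a = Diag (1\<^sub>m (nx * dim_row S) - S \<otimes>\<^sub>k 1\<^sub>m nx) in a @\<^sub>v a)"

text \<open>The two problems are given by their feasible sets and objectives; \<open>n\<close> is the number of nodes,
  \<open>du i\<close> and \<open>dy i\<close> are the input and output dimensions of node \<open>i\<close>. The order \<open>\<le>\<close> on vectors is
  the entrywise one and includes equality of dimensions.\<close>

type_synonym ssasp_point = "real vec \<times> real vec \<times> real mat \<times> real mat \<times> real mat"
type_synonym bigM_point = "real vec \<times> real vec \<times> real mat \<times> real mat \<times> real mat \<times> real mat"

definition ssasp_feasible ::
  "nat \<Rightarrow> (nat \<Rightarrow> nat) \<Rightarrow> (nat \<Rightarrow> nat) \<Rightarrow> real mat \<Rightarrow> real mat \<Rightarrow> real mat \<Rightarrow> real mat \<Rightarrow> real vec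
   \<Rightarrow> ssasp_point set" where
  "ssasp_feasible n du dy A B C \<Phi> \<phi> = {(\<pi>, \<gamma>, N, M, P).
     binary_vec n \<pi> \<and> binary_vec n \<gamma> \<and>
     N \<in> carrier_mat (dim_col B) (dim_row C) \<and>
     M \<in> carrier_mat (dim_col B) (dim_col B) \<and>
     P \<in> carrier_mat (dim_row A) (dim_row A) \<and> P\<^sup>T = P \<and>
     (let S = selection_mat du \<pi>; G = selection_mat dy \<gamma> in
        neg_def (A\<^sup>T * P + P * A + C\<^sup>T * G * N\<^sup>T * S * B\<^sup>T + B * S * N * G * C) \<and>
        B * S * M = P * B * S) \<and>
     pos_def P \<and>
     \<Phi> *\<^sub>v (\<pi> @\<^sub>v \<gamma>) \<le> \<phi>}"

fun ssasp_cost :: "nat \<Rightarrow> ssasp_point \<Rightarrow> real" where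
  "ssasp_cost n (\<pi>, \<gamma>, N, M, P) = (\<Sum>k<n. \<pi> $ k + \<gamma> $ k)"

definition bigM_feasible ::
  "nat \<Rightarrow> (nat \<Rightarrow> nat) \<Rightarrow> (nat \<Rightarrow> nat) \<Rightarrow> real mat \<Rightarrow> real mat \<Rightarrow> real mat \<Rightarrow> real mat \<Rightarrow> real vec
   \<Rightarrow> real \<Rightarrow> real \<Rightarrow> real \<Rightarrow> bigM_point set" where
  "bigM_feasible n du dy A B C \<Phi> \<phi> L1 L2 L3 = {(\<pi>, \<gamma>, N, M, P, \<Theta>).
     binary_vec n \<pi> \<and> binary_vec n \<gamma> \<and>
     N \<in> carrier_mat (dim_col B) (dim_row C) \<and>
     M \<in> carrier_mat (dim_col B) (dim_col B) \<and>
     P \<in> carrier_mat (dim_row A) (dim_row A) \<and> P\<^sup>T = P \<and>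
     \<Theta> \<in> carrier_mat (dim_col B) (dim_row C) \<and>
     neg_def (A\<^sup>T * P + P * A + C\<^sup>T * \<Theta>\<^sup>T * B\<^sup>T + B * \<Theta> * C) \<and>
     (let S = selection_mat du \<pi>; G = selection_mat dy \<gamma> in
        Psi1 N \<Theta> \<le> L1 \<cdot>\<^sub>v Delta1 G S \<and>
        Psi2 M (Omega B P) \<le> L2 \<cdot>\<^sub>v Delta2 S \<and>
        Psi3 (Xi B P) \<le> L3 \<cdot>\<^sub>v Delta3 (dim_row A) S) \<and>
     pos_def P \<and>
     \<Phi> *\<^sub>v (\<pi> @\<^sub>v \<gamma>) \<le> \<phi>}"

fun bigM_cost :: "nat \<Rightarrow> bigM_point \<Rightarrow> real" where
  "bigM_cost n (\<pi>, \<gamma>, N, M, P, \<Theta>) = (\<Sum>k<n. \<pi> $ k + \<gamma> $ k)"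

text \<open>The infimum is taken in the extended reals, so that an infeasible problem has value \<open>\<infinity>\<close>.\<close>

definition optimal_value :: "('z \<Rightarrow> real) \<Rightarrow> 'z set \<Rightarrow> ereal" where
  "optimal_value f F = (INF z \<in> F. ereal (f z))"

definition is_minimizer :: "('z \<Rightarrow> real) \<Rightarrow> 'z set \<Rightarrow> 'z \<Rightarrow> bool" where
  "is_minimizer f F z \<longleftrightarrow> is_arg_min f (\<lambda>z. z \<in> F) z"

definition entries_bounded :: "real \<Rightarrow> real mat \<Rightarrow> bool" where
  "entries_bounded R X \<longleftrightarrow> (\<forall>x \<in> elements_mat X. \<bar>x\<bar> \<le> R)"

text \<open>Equivalence of a problem \<open>(F, f)\<close> in the variables \<open>(\<pi>, \<gamma>, N, M, P)\<close> with a problem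
  \<open>(G, g)\<close> that has the additional variable \<open>\<Theta>\<close>. Forgetting \<open>\<Theta>\<close> maps feasible points and minimizers
  of the second problem to feasible points and minimizers of the first. Conversely, every feasible
  point or minimizer of the first gives one of the second with the same selections \<open>(\<pi>, \<gamma>)\<close>, and it
  suffices to add a suitable \<open>\<Theta>\<close> if its continuous variables are bounded by \<open>R\<close>. This bound cannot
  be dropped for fixed big-M constants: the feasible set of \<open>(F, f)\<close> is in general unbounded in
  \<open>(N, M, P)\<close>, being invariant under their simultaneous positive scaling, whereas the big-M
  constraints bound \<open>N\<close> and \<open>\<Theta>\<close> entrywise by multiples of the constants.\<close>

definition equivalent_problems ::
  "real \<Rightarrow> (ssasp_point \<Rightarrow> real) \<Rightarrow> ssasp_point set \<Rightarrow> (bigM_point \<Rightarrow> real) \<Rightarrow> bigM_point set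
   \<Rightarrow> bool" where
  "equivalent_problems R f F g G \<longleftrightarrow>
     optimal_value f F = optimal_value g G \<and>
     (\<forall>\<pi> \<gamma> N M P \<Theta>. (\<pi>, \<gamma>, N, M, P, \<Theta>) \<in> G \<longrightarrow>
        (\<pi>, \<gamma>, N, M, P) \<in> F \<and> f (\<pi>, \<gamma>, N, M, P) = g (\<pi>, \<gamma>, N, M, P, \<Theta>)) \<and>
     (\<forall>\<pi> \<gamma> N M P. (\<pi>, \<gamma>, N, M, P) \<in> F \<longrightarrow>
        (\<exists>N' M' P' \<Theta>. (\<pi>, \<gamma>, N', M', P', \<Theta>) \<in> G \<and>
           g (\<pi>, \<gamma>, N', M', P', \<Theta>) = f (\<pi>, \<gamma>, N, M, P))) \<and>
     (\<forall>\<pi> \<gamma> N M P. (\<pi>, \<gamma>, N, M, P) \<in> F \<and>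
        entries_bounded R N \<and> entries_bounded R M \<and> entries_bounded R P \<longrightarrow>
        (\<exists>\<Theta>. (\<pi>, \<gamma>, N, M, P, \<Theta>) \<in> G)) \<and>
     (\<forall>\<pi> \<gamma> N M P \<Theta>. is_minimizer g G (\<pi>, \<gamma>, N, M, P, \<Theta>) \<longrightarrow> is_minimizer f F (\<pi>, \<gamma>, N, M, P)) \<and>
     (\<forall>\<pi> \<gamma> N M P. is_minimizer f F (\<pi>, \<gamma>, N, M, P) \<longrightarrow>
        (\<exists>N' M' P' \<Theta>. is_minimizer g G (\<pi>, \<gamma>, N', M', P', \<Theta>))) \<and>
     (\<forall>\<pi> \<gamma> N M P. is_minimizer f F (\<pi>, \<gamma>, N, M, P) \<and>
        entries_bounded R N \<and> entries_bounded R M \<and> entries_bounded R P \<longrightarrow>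
        (\<exists>\<Theta>. is_minimizer g G (\<pi>, \<gamma>, N, M, P, \<Theta>)))"

end

theory Submission
  imports Defs
begin

text \<open>Read entrywise, the constraint on \<open>\<Psi>\<^sub>1\<close> forces \<open>\<Theta> = \<Pi> N \<Gamma>\<close>, the one on \<open>\<Psi>\<^sub>2\<close> forces
  \<open>\<Omega>(P) \<Pi> = \<Pi> M\<close>, and the one on \<open>\<Psi>\<^sub>3\<close> forces \<open>\<Xi>(P) \<Pi> = 0\<close>; conversely these equations imply the
  constraints as soon as the constants dominate the entries of \<open>N\<close>, \<open>M\<close>, \<open>\<Omega>(P)\<close> and \<open>\<Xi>(P)\<close>. Since
  \<open>(B\<^sup>T B)\<^sup>-\<^sup>1 B\<^sup>T\<close> is a left inverse of \<open>B\<close> and \<open>\<Xi>(P) = P B - B \<Omega>(P)\<close>, the last two equations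
  together are equivalent to \<open>B \<Pi> M = P B \<Pi>\<close>. A feasible point with large entries is first shrunk: the
  constraints on \<open>(N, M, P)\<close> are invariant under positive scaling.\<close>

subsection \<open>Matrices of full column rank\<close>

text \<open>A nonzero kernel vector is a linear dependence among the columns, whereas rank
  \<open>nc\<close> makes the \<open>nc\<close> columns independent.\<close>

lemma full_col_rank_mult_vec_eq_0:
  fixes B :: "real mat"
  assumes B: "B \<in> carrier_mat nr nc" and rank: "full_col_rank B"
    and v: "v \<in> carrier_vec nc" and Bv: "B *\<^sub>v v = 0\<^sub>v nr"
  shows "v = 0\<^sub>v nc"
proof (rule ccontr)
  assume nz: "v \<noteq> 0\<^sub>v nc"
  interpret vec_space "TYPE(real)" nr .
  have rk: "rank B = nc" using B rank by (auto simp: full_col_rank_def)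
  obtain S where S: "maximal S (\<lambda>T. T \<subseteq> set (cols B) \<and> lin_indpt T)"
    using maximal_exists[of "\<lambda>T. T \<subseteq> set (cols B) \<and> lin_indpt T" "card (set (cols B))" "{}"]
    by (meson List.finite_set card_mono empty_iff empty_subsetI finite_lin_indpt2 rev_finite_subset)
  \<comment> \<open>Linear independence is a property of the set of columns, in which repeated
    columns would collapse. Counting excludes this: an independent subset of size \<open>nc\<close>
    leaves room only for pairwise distinct columns.\<close>
  have "nc = card S" using rank_card_indpt[OF B S] rk by simp
  also have "\<dots> \<le> card (set (cols B))"
    using S by (auto simp: maximal_def intro: card_mono)
  finally have "card (set (cols B)) = length (cols B)"
    using card_length[of "cols B"] B by auto
  then have dist: "distinct (cols B)" by (rule card_distinct)
  show False
    using lin_depI[OF B v nz Bv dist] full_rank_lin_indpt[OF B rk dist] by blast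
qed

text \<open>The Gram matrix is nonsingular: if it annihilates \<open>v\<close>, then
  \<open>B *\<^sub>v v\<close> has squared length zero, so \<open>v\<close> lies in the trivial
  kernel of \<open>B\<close>. Hence \<open>mat_inverse\<close> does not return \<open>None\<close>,
  and \<open>the\<close> yields the actual inverse.\<close>

lemma full_col_rank_left_inverse:
  fixes B :: "real mat"
  assumes B: "B \<in> carrier_mat nr nc" and rank: "full_col_rank B"
  shows "the (mat_inverse (B\<^sup>T * B)) \<in> carrier_mat nc nc"
    and "the (mat_inverse (B\<^sup>T * B)) * B\<^sup>T * B = 1\<^sub>m nc"
proof -
  have G: "B\<^sup>T * B \<in> carrier_mat nc nc" using B by auto
  have "det (B\<^sup>T * B) \<noteq> 0"
  proof
    assume "det (B\<^sup>T * B) = 0"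
    then obtain v where v: "v \<in> carrier_vec nc" "v \<noteq> 0\<^sub>v nc" and z: "(B\<^sup>T * B) *\<^sub>v v = 0\<^sub>v nc"
      using det_0_iff_vec_prod_zero_field[OF G] by auto
    have Bv: "B *\<^sub>v v \<in> carrier_vec nr" using B v by auto
    have "(B *\<^sub>v v) \<bullet> (B *\<^sub>v v) = v \<bullet> (B\<^sup>T *\<^sub>v (B *\<^sub>v v))"
      using transpose_vec_mult_scalar[OF B v(1) Bv] Bv B v
      by (metis (no_types) comm_scalar_prod mult_mat_vec_carrier transpose_carrier_mat)
    also have "\<dots> = 0"
      using z B v by (simp add: assoc_mult_mat_vec[of _ nc nr _ nc])
    finally have "(B *\<^sub>v v) \<bullet> (B *\<^sub>v v) = 0" .
    then have "(\<Sum>i<nr. ((B *\<^sub>v v) $ i)\<^sup>2) = 0"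
      unfolding scalar_prod_def power2_eq_square atLeast0LessThan carrier_vecD[OF Bv] .
    then have "B *\<^sub>v v = 0\<^sub>v nr"
      using B Bv by (intro eq_vecI) (simp_all add: sum_nonneg_eq_0_iff del: index_mult_mat_vec)
    then show False using full_col_rank_mult_vec_eq_0[OF B rank v(1)] v(2) by simp
  qed
  then have "B\<^sup>T * B \<in> Units (ring_mat TYPE(real) nc ())"
    by (rule det_non_zero_imp_unit[OF G])
  then obtain X where X: "mat_inverse (B\<^sup>T * B) = Some X"
    using mat_inverse(1)[OF G] by fastforce
  note inv = mat_inverse(2)[OF G X]
  show "the (mat_inverse (B\<^sup>T * B)) \<in> carrier_mat nc nc" using inv X by auto
  show "the (mat_inverse (B\<^sup>T * B)) * B\<^sup>T * B = 1\<^sub>m nc"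
    using inv X B by (simp add: assoc_mult_mat[of _ nc nc _ nr _ nc])
qed

section \<open>Splitting \<open>B * S * M = P * B * S\<close> by means of \<open>Omega\<close> and
  \<open>Xi\<close>\<close>

lemma Omega_carrier:
  assumes "B \<in> carrier_mat nx nu" "full_col_rank B" "P \<in> carrier_mat nx nx"
  shows "Omega B P \<in> carrier_mat nu nu"
  using full_col_rank_left_inverse(1)[OF assms(1,2)] assms by (auto simp: Omega_def)

lemma Xi_carrier:
  assumes "B \<in> carrier_mat nx nu" "P \<in> carrier_mat nx nx"
  shows "Xi B P \<in> carrier_mat nx nu"
  using assms by (auto simp: Xi_def)

text \<open>\<open>B * Omega B P\<close> is the orthogonal projection of the columns of
  \<open>P * B\<close> onto the column space of \<open>B\<close>, so \<open>Xi\<close> is the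
  remaining component. The proof only regroups products.\<close>

lemma Xi_eq_residual:
  assumes B: "B \<in> carrier_mat nx nu" and r: "full_col_rank B" and P: "P \<in> carrier_mat nx nx"
  shows "Xi B P = P * B - B * Omega B P"
proof -
  define J where "J = the (mat_inverse (B\<^sup>T * B))"
  have J: "J \<in> carrier_mat nu nu"
    using full_col_rank_left_inverse(1)[OF B r] by (simp add: J_def)
  have "Xi B P = (1\<^sub>m nx - B * J * B\<^sup>T) * (P * B)"
    unfolding Xi_def J_def[symmetric] carrier_matD(1)[OF B]
    using B P J by (intro assoc_mult_mat) auto
  also have "\<dots> = P * B - B * J * B\<^sup>T * (P * B)"
    using B P J by (subst minus_mult_distrib_mat[of _ nx nx]) auto
  also have "B * J * B\<^sup>T * (P * B) = B * (J * B\<^sup>T) * (P * B)"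
    using B P J by (simp add: assoc_mult_mat[of _ nx nu _ nu _ nx])
  also have "\<dots> = B * (J * B\<^sup>T * (P * B))"
    using B P J by (intro assoc_mult_mat) auto
  also have "J * B\<^sup>T * (P * B) = J * B\<^sup>T * P * B"
    using B P J by (intro assoc_mult_mat[symmetric]) auto
  finally show ?thesis by (simp add: Omega_def J_def)
qed

lemma minus_mat_eq_zeroD:
  fixes X Y :: "'a :: group_add mat"
  assumes "X \<in> carrier_mat nr nc" "Y \<in> carrier_mat nr nc" "X - Y = 0\<^sub>m nr nc"
  shows "X = Y"
proof (rule eq_matI)
  fix i j assume ij: "i < dim_row Y" "j < dim_col Y"
  then have "(X - Y) $$ (i, j) = 0" using assms(2) unfolding assms(3) by simp
  then show "X $$ (i, j) = Y $$ (i, j)" using ij by simp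
qed (use assms in auto)

lemma structured_constraint_iff:
  assumes B: "B \<in> carrier_mat nx nu" and r: "full_col_rank B" and P: "P \<in> carrier_mat nx nx"
    and S: "S \<in> carrier_mat nu nu" and M: "M \<in> carrier_mat nu nu"
  shows "B * S * M = P * B * S \<longleftrightarrow>
    Omega B P * S = S * M \<and> Xi B P * S = 0\<^sub>m nx nu"
proof -
  define J where "J = the (mat_inverse (B\<^sup>T * B)) * B\<^sup>T"
  have J: "J \<in> carrier_mat nu nx"
    using full_col_rank_left_inverse(1)[OF B r] B by (auto simp: J_def)
  have JB: "J * B = 1\<^sub>m nu"
    using full_col_rank_left_inverse(2)[OF B r] by (simp add: J_def)
  define W where "W = Omega B P"
  have W: "W \<in> carrier_mat nu nu" using Omega_carrier[OF B r P] by (simp add: W_def)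
  have W_eq: "W = J * (P * B)"
    unfolding W_def Omega_def J_def[symmetric] using B P J by (intro assoc_mult_mat) auto
  have BSM: "B * S * M = B * (S * M)" using B S M by (intro assoc_mult_mat)
  \<comment> \<open>This identity carries both directions: once \<open>W * S = S * M\<close>, the
    residual \<open>Xi B P * S\<close> is exactly the difference of the two sides of the structured
    constraint.\<close>
  have XS: "Xi B P * S = P * B * S - B * (W * S)"
  proof -
    have "Xi B P * S = P * B * S - B * W * S"
      unfolding Xi_eq_residual[OF B r P] W_def[symmetric]
      using B P S W by (intro minus_mult_distrib_mat) auto
    also have "B * W * S = B * (W * S)" using B W S by (intro assoc_mult_mat)
    finally show ?thesis .
  qed
  have PBS: "P * B * S \<in> carrier_mat nx nu" using B P S by auto
  have BWS: "B * (W * S) \<in> carrier_mat nx nu" using B W S by auto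
  show ?thesis
  proof
    assume eq: "B * S * M = P * B * S"
    \<comment> \<open>Multiplying the constraint from the left by \<open>J\<close> cancels
      \<open>B\<close>, which leaves the component inside the column space of
      \<open>B\<close>.\<close>
    have "W * S = J * (P * B * S)"
      unfolding W_eq using B P J S by (intro assoc_mult_mat) auto
    also have "\<dots> = J * (B * (S * M))" using eq BSM by simp
    also have "\<dots> = J * B * (S * M)" using B J S M by (intro assoc_mult_mat[symmetric]) auto
    also have "\<dots> = S * M" using JB S M by simp
    finally have WS: "W * S = S * M" .
    then have "Xi B P * S = P * B * S - P * B * S" using XS eq BSM by simp
    then show "Omega B P * S = S * M \<and> Xi B P * S = 0\<^sub>m nx nu"
      using WS PBS by (simp add: W_def)
  next
    assume "Omega B P * S = S * M \<and> Xi B P * S = 0\<^sub>m nx nu"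
    then have WS: "W * S = S * M" and "P * B * S - B * (W * S) = 0\<^sub>m nx nu"
      using XS by (auto simp: W_def)
    then have "P * B * S = B * (W * S)" using minus_mat_eq_zeroD[OF PBS BWS] by blast
    then show "B * S * M = P * B * S" using WS BSM by simp
  qed
qed

subsection \<open>Selection matrices\<close>

lemma diag_block_mat_carrier:
  assumes "\<And>i. i < n \<Longrightarrow> Ms i \<in> carrier_mat (r i) (c i)"
  shows "diag_block_mat (map Ms [0..<n]) \<in> carrier_mat (\<Sum>i<n. r i) (\<Sum>i<n. c i)"
  using assms
proof (induction n)
  case (Suc n)
  then have "Ms n \<in> carrier_mat (r n) (c n)"
    and "diag_block_mat (map Ms [0..<n]) \<in> carrier_mat (\<Sum>i<n. r i) (\<Sum>i<n. c i)" by auto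
  then show ?case by (auto simp: diag_block_mat_last Let_def)
qed auto

text \<open>Square blocks keep their own diagonals on the diagonal of the large matrix; with
  rectangular blocks the later diagonals would be shifted off it.\<close>

lemma diagonal_diag_block_mat:
  assumes "\<And>X. X \<in> set Xs \<Longrightarrow> square_mat X \<and> diagonal_mat X"
  shows "diagonal_mat (diag_block_mat Xs)"
  using assms
proof (induction Xs)
  case (Cons X Xs)
  have sq: "square_mat X" "square_mat (diag_block_mat Xs)"
    using Cons.prems diag_block_mat_square[of Xs] by (meson list.set_intros)+
  have "diagonal_mat X" "diagonal_mat (diag_block_mat Xs)" using Cons by auto
  then show ?case using sq by (auto simp: diagonal_mat_def Let_def)
qed (auto simp: diagonal_mat_def)

lemma selection_mat_carrier:
  assumes "binary_vec n s"
  shows "selection_mat d s \<in> carrier_mat (\<Sum>i<n. d i) (\<Sum>i<n. d i)"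
  using assms unfolding selection_mat_def binary_vec_def
  by (auto intro!: diag_block_mat_carrier)

lemma diagonal_selection_mat: "diagonal_mat (selection_mat d s)"
  unfolding selection_mat_def by (rule diagonal_diag_block_mat) (auto simp: diagonal_mat_def)

text \<open>There is no need to locate the block that contains position \<open>k\<close>: every
  entry of a block-diagonal matrix is 0 or an entry of some block, and the blocks have only the
  entries 0 and \<open>s $ i\<close>.\<close>

lemma selection_mat_diag_entry:
  assumes s: "binary_vec n s" and k: "k < (\<Sum>i<n. d i)"
  shows "selection_mat d s $$ (k, k) \<in> {0, 1}"
proof -
  let ?X = "\<lambda>i. s $ i \<cdot>\<^sub>m 1\<^sub>m (d i)"
  have "selection_mat d s $$ (k, k) \<in> elements_mat (selection_mat d s)"
    using selection_mat_carrier[OF s, of d] k by auto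
  also have "\<dots> \<subseteq> {0} \<union> \<Union> (set (map elements_mat (map ?X [0..<dim_vec s])))"
    unfolding selection_mat_def by (rule elements_diag_block_mat)
  also have "\<dots> \<subseteq> {0, 1}"
  proof -
    have "x \<in> {0, 1}" if i: "i \<in> set [0..<dim_vec s]" and x: "x \<in> elements_mat (?X i)" for i x
    proof -
      have "s $ i \<in> {0, 1}" using s i by (auto simp: binary_vec_def)
      then show ?thesis using elements_matD[OF x] by auto
    qed
    then show ?thesis unfolding set_map by blast
  qed
  finally show ?thesis .
qed

lemma diagonal_mult_index:
  fixes D X :: "real mat"
  assumes D: "D \<in> carrier_mat nr nr" "diagonal_mat D" and X: "X \<in> carrier_mat nr nc"
    and ij: "i < nr" "j < nc"
  shows "(D * X) $$ (i, j) = D $$ (i, i) * X $$ (i, j)"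
proof -
  have "(D * X) $$ (i, j) = (\<Sum>k\<in>{0..<nr}. D $$ (i, k) * X $$ (k, j))"
    using assms by (simp add: scalar_prod_def)
  also have "\<dots> = (\<Sum>k\<in>{i}. D $$ (i, k) * X $$ (k, j))"
    using assms by (intro sum.mono_neutral_right) (auto simp: diagonal_mat_def)
  finally show ?thesis by simp
qed

lemma mult_diagonal_index:
  fixes D X :: "real mat"
  assumes D: "D \<in> carrier_mat nc nc" "diagonal_mat D" and X: "X \<in> carrier_mat nr nc"
    and ij: "i < nr" "j < nc"
  shows "(X * D) $$ (i, j) = X $$ (i, j) * D $$ (j, j)"
proof -
  have "(X * D) $$ (i, j) = (\<Sum>k\<in>{0..<nc}. X $$ (i, k) * D $$ (k, j))"
    using assms by (simp add: scalar_prod_def)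
  also have "\<dots> = (\<Sum>k\<in>{j}. X $$ (i, k) * D $$ (k, j))"
    using assms by (intro sum.mono_neutral_right) (auto simp: diagonal_mat_def)
  finally show ?thesis by simp
qed

lemma transpose_diagonal:
  assumes "D \<in> carrier_mat n n" "diagonal_mat D"
  shows "D\<^sup>T = D"
proof (rule eq_matI)
  fix i j assume "i < dim_row D" "j < dim_col D"
  then show "D\<^sup>T $$ (i, j) = D $$ (i, j)"
    using assms by (cases "i = j") (auto simp: diagonal_mat_def)
qed (use assms in auto)

subsection \<open>Entrywise form of the big-M constraints\<close>

lemma smult_append_vec: "c \<cdot>\<^sub>v (v @\<^sub>v w) = c \<cdot>\<^sub>v v @\<^sub>v c \<cdot>\<^sub>v w"
  by (intro eq_vecI) auto

lemma Diag_dim [simp]: "dim_vec (Diag X) = dim_row X"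
  by (simp add: Diag_def diag_mat_def)

lemma Diag_index: "k < dim_row X \<Longrightarrow> Diag X $ k = X $$ (k, k)"
  by (simp add: Diag_def diag_mat_def index_vec_of_list)

lemma Vec_dim [simp]: "dim_vec (Vec X) = dim_row X * dim_col X"
  by (simp add: Vec_def)

lemma column_index_less:
  fixes i j :: nat
  assumes "i < nr" "j < nc"
  shows "j * nr + i < nr * nc"
proof -
  have "j * nr + i < Suc j * nr" using assms by simp
  also have "\<dots> \<le> nc * nr" using assms by (intro mult_le_mono1) auto
  finally show ?thesis by (simp add: mult.commute)
qed

text \<open>The two signs combine to an absolute value, and \<open>k = j * nr + i\<close> translates
  between positions in the stacked vector and pairs of matrix indices.\<close>

lemma Vec_le_iff:
  assumes X: "X \<in> carrier_mat nr nc" and D: "D \<in> carrier_mat (nr * nc) (nr * nc)"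
  shows "Vec X \<le> c \<cdot>\<^sub>v Diag D \<and> - Vec X \<le> c \<cdot>\<^sub>v Diag D \<longleftrightarrow>
    (\<forall>i<nr. \<forall>j<nc. \<bar>X $$ (i, j)\<bar> \<le> c * D $$ (j * nr + i, j * nr + i))"
proof -
  have "Vec X \<le> c \<cdot>\<^sub>v Diag D \<and> - Vec X \<le> c \<cdot>\<^sub>v Diag D \<longleftrightarrow>
     (\<forall>k<nr * nc. \<bar>X $$ (k mod nr, k div nr)\<bar> \<le> c * D $$ (k, k))"
    using X D by (auto simp: less_eq_vec_def Vec_def Diag_index abs_le_iff)
  also have "\<dots> \<longleftrightarrow>
    (\<forall>i<nr. \<forall>j<nc. \<bar>X $$ (i, j)\<bar> \<le> c * D $$ (j * nr + i, j * nr + i))"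
  proof (intro iffI allI impI)
    fix i j assume *: "\<forall>k<nr * nc. \<bar>X $$ (k mod nr, k div nr)\<bar> \<le> c * D $$ (k, k)"
      and ij: "i < nr" "j < nc"
    from *[rule_format, OF column_index_less[OF ij]]
    show "\<bar>X $$ (i, j)\<bar> \<le> c * D $$ (j * nr + i, j * nr + i)" using ij by simp
  next
    fix k assume *: "\<forall>i<nr. \<forall>j<nc. \<bar>X $$ (i, j)\<bar> \<le> c * D $$ (j * nr + i, j * nr + i)"
      and k: "k < nr * nc"
    \<comment> \<open>Only for positive \<open>nr\<close> is \<open>k mod nr\<close> a valid row
      index; for \<open>nr = 0\<close> there is no \<open>k\<close> to consider.\<close>
    have "0 < nr" using k by (cases nr) auto
    moreover have "k div nr < nc" using k by (simp add: less_mult_imp_div_less mult.commute)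
    ultimately show "\<bar>X $$ (k mod nr, k div nr)\<bar> \<le> c * D $$ (k, k)"
      using *[rule_format, of "k mod nr" "k div nr"] by simp
  qed
  finally show ?thesis .
qed

text \<open>Peels one pair of blocks of opposite sign off the stacked inequality and leaves the
  tail. Applied twice, then followed by the primed variant for the last pair, it resolves the six
  blocks of \<open>Psi1\<close> and \<open>Psi2\<close>.\<close>

lemma Vec_append_le_iff:
  assumes X: "X \<in> carrier_mat nr nc" and D: "D \<in> carrier_mat (nr * nc) (nr * nc)"
  shows "Vec X @\<^sub>v - Vec X @\<^sub>v v \<le> c \<cdot>\<^sub>v (Diag D @\<^sub>v Diag D @\<^sub>v w) \<longleftrightarrow>
    (\<forall>i<nr. \<forall>j<nc. \<bar>X $$ (i, j)\<bar> \<le> c * D $$ (j * nr + i, j * nr + i)) \<and> v \<le> c \<cdot>\<^sub>v w"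
proof -
  have dims: "Vec X \<in> carrier_vec (nr * nc)" "- Vec X \<in> carrier_vec (nr * nc)"
    "c \<cdot>\<^sub>v Diag D \<in> carrier_vec (nr * nc)" using X D by (auto intro: carrier_vecI)
  show ?thesis
    using Vec_le_iff[OF X D, of c]
    unfolding smult_append_vec append_vec_le[OF dims(1,3)] append_vec_le[OF dims(2,3)] by blast
qed

lemma Vec_append_le_iff':
  assumes X: "X \<in> carrier_mat nr nc" and D: "D \<in> carrier_mat (nr * nc) (nr * nc)"
  shows "Vec X @\<^sub>v - Vec X \<le> c \<cdot>\<^sub>v (Diag D @\<^sub>v Diag D) \<longleftrightarrow>
    (\<forall>i<nr. \<forall>j<nc. \<bar>X $$ (i, j)\<bar> \<le> c * D $$ (j * nr + i, j * nr + i))"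
proof -
  have dims: "Vec X \<in> carrier_vec (nr * nc)" 
    "c \<cdot>\<^sub>v Diag D \<in> carrier_vec (nr * nc)" using X D by (auto intro: carrier_vecI)
  show ?thesis
    using Vec_le_iff[OF X D, of c] by (simp add: smult_append_vec append_vec_le[OF dims])
qed

lemma kronecker_carrier:
  assumes "X \<in> carrier_mat a b" "Y \<in> carrier_mat c d"
  shows "X \<otimes>\<^sub>k Y \<in> carrier_mat (a * c) (b * d)"
  using assms by (auto simp: kronecker_def)

text \<open>At the column-stacking position of entry \<open>(i, j)\<close> the left factor sees the
  column index \<open>j\<close> and the right factor the row index \<open>i\<close>. This is why a
  selection of rows appears as the right Kronecker factor and a selection of columns as the left
  one.\<close>

lemma kronecker_diag_index:
  assumes "X \<in> carrier_mat nc nc" "Y \<in> carrier_mat nr nr" "i < nr" "j < nc"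
  shows "(X \<otimes>\<^sub>k Y) $$ (j * nr + i, j * nr + i) = X $$ (j, j) * Y $$ (i, i)"
  using assms column_index_less[of i nr j nc] by (simp add: kronecker_def mult.commute)

lemma Psi1_le_iff:
  assumes \<Theta>: "\<Theta> \<in> carrier_mat nu ny" and N: "N \<in> carrier_mat nu ny"
    and S: "S \<in> carrier_mat nu nu" and G: "G \<in> carrier_mat ny ny"
  shows "Psi1 N \<Theta> \<le> c \<cdot>\<^sub>v Delta1 G S \<longleftrightarrow> (\<forall>i<nu. \<forall>j<ny.
    \<bar>\<Theta> $$ (i, j)\<bar> \<le> c * S $$ (i, i) \<and> \<bar>\<Theta> $$ (i, j)\<bar> \<le> c * G $$ (j, j) \<and>
    \<bar>\<Theta> $$ (i, j) - N $$ (i, j)\<bar> \<le> c * (2 - S $$ (i, i) - G $$ (j, j)))"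
proof -
  have K: "1\<^sub>m ny \<otimes>\<^sub>k S \<in> carrier_mat (nu * ny) (nu * ny)"
     "G \<otimes>\<^sub>k 1\<^sub>m nu \<in> carrier_mat (nu * ny) (nu * ny)"
    using kronecker_carrier[OF one_carrier_mat S, of ny]
      kronecker_carrier[OF G one_carrier_mat, of nu] by (simp_all add: mult.commute)
  have D: "2 \<cdot>\<^sub>m 1\<^sub>m (nu * ny) - 1\<^sub>m ny \<otimes>\<^sub>k S - G \<otimes>\<^sub>k 1\<^sub>m nu
      \<in> carrier_mat (nu * ny) (nu * ny)" using K by (auto intro: minus_carrier_mat)
  have T: "\<Theta> - N \<in> carrier_mat nu ny" using N by auto
  have dim: "dim_row G = ny" "dim_row S = nu" using G S by auto
  show ?thesis
    unfolding Psi1_def Delta1_def Let_def dim Vec_append_le_iff[OF \<Theta> K(1)]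
      Vec_append_le_iff[OF \<Theta> K(2)] Vec_append_le_iff'[OF T D]
    using assms K kronecker_diag_index[OF one_carrier_mat S] kronecker_diag_index[OF G one_carrier_mat]
    by (auto simp: column_index_less)
qed

lemma Psi2_le_iff:
  assumes M: "M \<in> carrier_mat nu nu" and W: "W \<in> carrier_mat nu nu"
    and S: "S \<in> carrier_mat nu nu"
  shows "Psi2 M W \<le> c \<cdot>\<^sub>v Delta2 S \<longleftrightarrow> (\<forall>i<nu. \<forall>j<nu.
    \<bar>M $$ (i, j)\<bar> \<le> c * (1 - S $$ (i, i) + S $$ (j, j)) \<and>
    \<bar>W $$ (i, j)\<bar> \<le> c * (1 + S $$ (i, i) - S $$ (j, j)) \<and>
    \<bar>M $$ (i, j) - W $$ (i, j)\<bar> \<le> c * (2 - S $$ (i, i) - S $$ (j, j)))"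
proof -
  have K: "1\<^sub>m nu \<otimes>\<^sub>k S \<in> carrier_mat (nu * nu) (nu * nu)"
     "S \<otimes>\<^sub>k 1\<^sub>m nu \<in> carrier_mat (nu * nu) (nu * nu)"
    using kronecker_carrier[OF one_carrier_mat S, of nu]
      kronecker_carrier[OF S one_carrier_mat, of nu] by simp_all
  have D: "1\<^sub>m (nu * nu) - 1\<^sub>m nu \<otimes>\<^sub>k S + S \<otimes>\<^sub>k 1\<^sub>m nu \<in> carrier_mat (nu * nu) (nu * nu)"
    "1\<^sub>m (nu * nu) + 1\<^sub>m nu \<otimes>\<^sub>k S - S \<otimes>\<^sub>k 1\<^sub>m nu \<in> carrier_mat (nu * nu) (nu * nu)"
    "2 \<cdot>\<^sub>m 1\<^sub>m (nu * nu) - 1\<^sub>m nu \<otimes>\<^sub>k S - S \<otimes>\<^sub>k 1\<^sub>m nu \<in> carrier_mat (nu * nu) (nu * nu)"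
    using K by (auto intro: minus_carrier_mat)
  have T: "M - W \<in> carrier_mat nu nu" using W by auto
  have dim: "dim_row S = nu" using S by auto
  show ?thesis
    unfolding Psi2_def Delta2_def Let_def dim power2_eq_square Vec_append_le_iff[OF M D(1)]
      Vec_append_le_iff[OF W D(2)] Vec_append_le_iff'[OF T D(3)]
    using assms K kronecker_diag_index[OF one_carrier_mat S] kronecker_diag_index[OF S one_carrier_mat]
    by (auto simp: column_index_less)
qed

lemma Psi3_le_iff:
  assumes X: "X \<in> carrier_mat nx nu" and S: "S \<in> carrier_mat nu nu"
  shows "Psi3 X \<le> c \<cdot>\<^sub>v Delta3 nx S \<longleftrightarrow>
    (\<forall>i<nx. \<forall>j<nu. \<bar>X $$ (i, j)\<bar> \<le> c * (1 - S $$ (j, j)))"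
proof -
  have K: "S \<otimes>\<^sub>k 1\<^sub>m nx \<in> carrier_mat (nx * nu) (nx * nu)"
    using kronecker_carrier[OF S one_carrier_mat, of nx] by (simp add: mult.commute)
  have D: "1\<^sub>m (nx * nu) - S \<otimes>\<^sub>k 1\<^sub>m nx \<in> carrier_mat (nx * nu) (nx * nu)"
    using K by (auto intro: minus_carrier_mat)
  have dim: "dim_row S = nu" using S by auto
  show ?thesis
    unfolding Psi3_def Delta3_def Let_def dim Vec_append_le_iff'[OF X D]
    using assms K kronecker_diag_index[OF S one_carrier_mat] by (auto simp: column_index_less)
qed

section \<open>From entrywise big-M bounds to matrix equations and back\<close>

definition selection :: "nat \<Rightarrow> real mat \<Rightarrow> bool" where
  "selection n S \<longleftrightarrow> S \<in> carrier_mat n n \<and> diagonal_mat S \<and> (\<forall>i<n. S $$ (i, i) \<in> {0, 1})"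

text \<open>Passes from the block structure to the three properties on which the big-M lemmas below
  rely.\<close>

lemma selection_selection_mat:
  assumes "binary_vec n s" shows "selection (\<Sum>i<n. d i) (selection_mat d s)"
  using selection_mat_carrier[OF assms] diagonal_selection_mat selection_mat_diag_entry[OF assms]
  unfolding selection_def by blast

lemma entries_bounded_iff:
  assumes "X \<in> carrier_mat nr nc"
  shows "entries_bounded c X \<longleftrightarrow> (\<forall>i<nr. \<forall>j<nc. \<bar>X $$ (i, j)\<bar> \<le> c)"
proof
  assume "entries_bounded c X"
  then show "\<forall>i<nr. \<forall>j<nc. \<bar>X $$ (i, j)\<bar> \<le> c"
    using elements_matI[OF assms] by (auto simp: entries_bounded_def)
next
  assume "\<forall>i<nr. \<forall>j<nc. \<bar>X $$ (i, j)\<bar> \<le> c"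
  then show "entries_bounded c X" using assms by (auto simp: entries_bounded_def dest!: elements_matD)
qed

lemma selected_mult_index:
  assumes S: "selection nr S" and G: "selection nc G" and X: "X \<in> carrier_mat nr nc"
    and ij: "i < nr" "j < nc"
  shows "(S * X * G) $$ (i, j) = S $$ (i, i) * X $$ (i, j) * G $$ (j, j)"
proof -
  have "S * X \<in> carrier_mat nr nc" using S X by (auto simp: selection_def)
  from mult_diagonal_index[OF _ _ this ij, of G] diagonal_mult_index[OF _ _ X ij, of S] S G
  show ?thesis by (simp add: selection_def)
qed

text \<open>Where both \<open>S $$ (i, i)\<close> and \<open>G $$ (j, j)\<close> are 1, the third
  bound has right-hand side 0 and gives the entry of \<open>N\<close>; where one of them is 0, the
  corresponding bound makes the entry of \<open>\<Theta>\<close> vanish. The size of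
  \<open>c\<close> does not enter.\<close>

lemma Psi1_leD:
  assumes S: "selection nu S" and G: "selection ny G"
    and \<Theta>: "\<Theta> \<in> carrier_mat nu ny" and N: "N \<in> carrier_mat nu ny"
    and le: "Psi1 N \<Theta> \<le> c \<cdot>\<^sub>v Delta1 G S"
  shows "\<Theta> = S * N * G"
proof (rule eq_matI)
  have carrier: "S \<in> carrier_mat nu nu" "G \<in> carrier_mat ny ny" using S G by (auto simp: selection_def)
  then show "dim_row \<Theta> = dim_row (S * N * G)" "dim_col \<Theta> = dim_col (S * N * G)" using \<Theta> by auto
  fix i j assume "i < dim_row (S * N * G)" "j < dim_col (S * N * G)"
  then have ij: "i < nu" "j < ny" using carrier by auto
  have "S $$ (i, i) \<in> {0, 1}" "G $$ (j, j) \<in> {0, 1}" using S G ij by (auto simp: selection_def)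
  then show "\<Theta> $$ (i, j) = (S * N * G) $$ (i, j)"
    using le[unfolded Psi1_le_iff[OF \<Theta> N carrier], rule_format, OF ij]
    unfolding selected_mult_index[OF S G N ij] by auto
qed

lemma Psi1_leI:
  assumes S: "selection nu S" and G: "selection ny G"
    and N: "N \<in> carrier_mat nu ny" and bd: "entries_bounded c N"
  shows "Psi1 N (S * N * G) \<le> c \<cdot>\<^sub>v Delta1 G S"
proof -
  have carrier: "S \<in> carrier_mat nu nu" "G \<in> carrier_mat ny ny" using S G by (auto simp: selection_def)
  have \<Theta>: "S * N * G \<in> carrier_mat nu ny" using carrier N by auto
  show ?thesis
    unfolding Psi1_le_iff[OF \<Theta> N carrier]
  proof (intro allI impI)
    fix i j assume ij: "i < nu" "j < ny"
    have "S $$ (i, i) \<in> {0, 1}" "G $$ (j, j) \<in> {0, 1}" using S G ij by (auto simp: selection_def)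
    moreover have "\<bar>N $$ (i, j)\<bar> \<le> c" using bd ij by (simp add: entries_bounded_iff[OF N])
    \<comment> \<open>If both indices are selected, the difference is 0 and the product entry is
      that of \<open>N\<close>. Otherwise the product entry is 0 and the third factor is at least 1;
      \<open>c\<close> is nonnegative because it dominates an absolute value.\<close>
    ultimately show "\<bar>(S * N * G) $$ (i, j)\<bar> \<le> c * S $$ (i, i) \<and>
      \<bar>(S * N * G) $$ (i, j)\<bar> \<le> c * G $$ (j, j) \<and>
      \<bar>(S * N * G) $$ (i, j) - N $$ (i, j)\<bar> \<le> c * (2 - S $$ (i, i) - G $$ (j, j))"
      unfolding selected_mult_index[OF S G N ij] by auto
  qed
qed

text \<open>Each case of the selection of \<open>i\<close> and \<open>j\<close> is settled by one
  bound: the third gives \<open>M = W\<close> at the entry if both are selected, the first kills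
  \<open>M\<close> if only \<open>i\<close> is, the second kills \<open>W\<close> if only
  \<open>j\<close> is. If neither is selected, both products have entry 0.\<close>

lemma Psi2_leD:
  assumes S: "selection nu S" and M: "M \<in> carrier_mat nu nu" and W: "W \<in> carrier_mat nu nu"
    and le: "Psi2 M W \<le> c \<cdot>\<^sub>v Delta2 S"
  shows "W * S = S * M"
proof (rule eq_matI)
  have carrier: "S \<in> carrier_mat nu nu" "diagonal_mat S" using S by (auto simp: selection_def)
  then show "dim_row (W * S) = dim_row (S * M)" "dim_col (W * S) = dim_col (S * M)" using M W by auto
  fix i j assume "i < dim_row (S * M)" "j < dim_col (S * M)"
  then have ij: "i < nu" "j < nu" using carrier M by auto
  have "S $$ (i, i) \<in> {0, 1}" "S $$ (j, j) \<in> {0, 1}" using S ij by (auto simp: selection_def)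
  then show "(W * S) $$ (i, j) = (S * M) $$ (i, j)"
    using le[unfolded Psi2_le_iff[OF M W carrier(1)], rule_format, OF ij]
    unfolding mult_diagonal_index[OF carrier W ij] diagonal_mult_index[OF carrier M ij] by auto
qed

lemma Psi2_leI:
  assumes S: "selection nu S" and M: "M \<in> carrier_mat nu nu" and W: "W \<in> carrier_mat nu nu"
    and eq: "W * S = S * M" and bd: "entries_bounded c M" "entries_bounded c W"
  shows "Psi2 M W \<le> c \<cdot>\<^sub>v Delta2 S"
proof -
  have carrier: "S \<in> carrier_mat nu nu" "diagonal_mat S" using S by (auto simp: selection_def)
  show ?thesis
    unfolding Psi2_le_iff[OF M W carrier(1)]
  proof (intro allI impI)
    fix i j assume ij: "i < nu" "j < nu"
    have "S $$ (i, i) \<in> {0, 1}" "S $$ (j, j) \<in> {0, 1}" using S ij by (auto simp: selection_def)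
    moreover have "\<bar>M $$ (i, j)\<bar> \<le> c" using bd(1) ij by (simp add: entries_bounded_iff[OF M])
    moreover have "\<bar>W $$ (i, j)\<bar> \<le> c" using bd(2) ij by (simp add: entries_bounded_iff[OF W])
    moreover have "W $$ (i, j) * S $$ (j, j) = S $$ (i, i) * M $$ (i, j)"
      using arg_cong[OF eq, of "\<lambda>X. X $$ (i, j)"]
      unfolding mult_diagonal_index[OF carrier W ij] diagonal_mult_index[OF carrier M ij] .
    \<comment> \<open>A right-hand side vanishes only where the entrywise equation already makes the
      left-hand side 0. If neither index is selected, the third bound is \<open>2 * c\<close>, which
      the triangle inequality supplies.\<close>
    ultimately show "\<bar>M $$ (i, j)\<bar> \<le> c * (1 - S $$ (i, i) + S $$ (j, j)) \<and>
      \<bar>W $$ (i, j)\<bar> \<le> c * (1 + S $$ (i, i) - S $$ (j, j)) \<and>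
      \<bar>M $$ (i, j) - W $$ (i, j)\<bar> \<le> c * (2 - S $$ (i, i) - S $$ (j, j))"
      by auto
  qed
qed

text \<open>A selected column of \<open>X\<close> has bound 0 and vanishes, while an unselected one
  is erased by the factor \<open>S\<close>.\<close>

lemma Psi3_leD:
  assumes S: "selection nu S" and X: "X \<in> carrier_mat nx nu"
    and le: "Psi3 X \<le> c \<cdot>\<^sub>v Delta3 nx S"
  shows "X * S = 0\<^sub>m nx nu"
proof (rule eq_matI)
  have carrier: "S \<in> carrier_mat nu nu" "diagonal_mat S" using S by (auto simp: selection_def)
  then show "dim_row (X * S) = dim_row (0\<^sub>m nx nu)" "dim_col (X * S) = dim_col (0\<^sub>m nx nu)"
    using X by auto
  fix i j assume "i < dim_row (0\<^sub>m nx nu)" "j < dim_col (0\<^sub>m nx nu)"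
  then have ij: "i < nx" "j < nu" by auto
  have "S $$ (j, j) \<in> {0, 1}" using S ij by (auto simp: selection_def)
  then show "(X * S) $$ (i, j) = 0\<^sub>m nx nu $$ (i, j)"
    using le[unfolded Psi3_le_iff[OF X carrier(1)], rule_format, OF ij] ij
    unfolding mult_diagonal_index[OF carrier X ij] by auto
qed

lemma Psi3_leI:
  assumes S: "selection nu S" and X: "X \<in> carrier_mat nx nu"
    and eq: "X * S = 0\<^sub>m nx nu" and bd: "entries_bounded c X"
  shows "Psi3 X \<le> c \<cdot>\<^sub>v Delta3 nx S"
proof -
  have carrier: "S \<in> carrier_mat nu nu" "diagonal_mat S" using S by (auto simp: selection_def)
  show ?thesis
    unfolding Psi3_le_iff[OF X carrier(1)]
  proof (intro allI impI)
    fix i j assume ij: "i < nx" "j < nu"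
    have "S $$ (j, j) \<in> {0, 1}" using S ij by (auto simp: selection_def)
    moreover have "\<bar>X $$ (i, j)\<bar> \<le> c" using bd ij by (simp add: entries_bounded_iff[OF X])
    moreover have "X $$ (i, j) * S $$ (j, j) = 0"
      using arg_cong[OF eq, of "\<lambda>X. X $$ (i, j)"] ij
      unfolding mult_diagonal_index[OF carrier X ij] by simp
    ultimately show "\<bar>X $$ (i, j)\<bar> \<le> c * (1 - S $$ (j, j))" by auto
  qed
qed

subsection \<open>Entry bounds\<close>

lemma entries_bounded_mono: "entries_bounded a X \<Longrightarrow> a \<le> b \<Longrightarrow> entries_bounded b X"
  unfolding entries_bounded_def by fastforce

lemma ex_entries_bounded: "\<exists>c\<ge>0. entries_bounded c X"
proof (intro exI conjI)
  \<comment> \<open>Inserting 0 keeps the set nonempty for a matrix without entries, and makes the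
    maximum nonnegative.\<close>
  have fin: "finite (insert 0 (abs ` elements_mat X))" by (simp add: elements_mat_def)
  show "0 \<le> Max (insert 0 (abs ` elements_mat X))" by (rule Max_ge[OF fin]) simp
  show "entries_bounded (Max (insert 0 (abs ` elements_mat X))) X"
    unfolding entries_bounded_def by (intro ballI Max_ge[OF fin]) simp
qed

lemma entries_bounded_mult:
  assumes X: "X \<in> carrier_mat nr n" and Y: "Y \<in> carrier_mat n nc"
    and bd: "entries_bounded a X" "entries_bounded b Y" and a: "a \<ge> 0"
  shows "entries_bounded (real n * (a * b)) (X * Y)"
proof -
  have XY: "X * Y \<in> carrier_mat nr nc" using X Y by auto
  show ?thesis
    unfolding entries_bounded_iff[OF XY]
  proof (intro allI impI)
    fix i j assume ij: "i < nr" "j < nc"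
    have "\<bar>(X * Y) $$ (i, j)\<bar> = \<bar>\<Sum>k<n. X $$ (i, k) * Y $$ (k, j)\<bar>"
      using X Y ij by (simp add: scalar_prod_def atLeast0LessThan)
    also have "\<dots> \<le> (\<Sum>k<n. \<bar>X $$ (i, k) * Y $$ (k, j)\<bar>)" by (rule sum_abs)
    also have "\<dots> \<le> (\<Sum>k<n. a * b)"
    proof (rule sum_mono)
      fix k assume "k \<in> {..<n}"
      then show "\<bar>X $$ (i, k) * Y $$ (k, j)\<bar> \<le> a * b"
        using bd a ij unfolding entries_bounded_iff[OF X] entries_bounded_iff[OF Y] abs_mult
        by (intro mult_mono) auto
    qed
    finally show "\<bar>(X * Y) $$ (i, j)\<bar> \<le> real n * (a * b)" by simp
  qed
qed

text \<open>The bound is uniform in \<open>P\<close>: it depends only on \<open>r\<close>, the inner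
  dimension and bounds for \<open>U\<close> and \<open>V\<close>. Both \<open>Omega B P\<close> and
  \<open>Xi B P\<close> have the form \<open>U * P * V\<close>, so one big-M constant can serve all
  \<open>P\<close> with entries bounded by \<open>r\<close>.\<close>

lemma ex_entries_bounded_sandwich:
  assumes U: "U \<in> carrier_mat nr n" and V: "V \<in> carrier_mat n nc" and r: "r \<ge> 0"
  shows "\<exists>c. \<forall>P \<in> carrier_mat n n. entries_bounded r P \<longrightarrow> entries_bounded c (U * P * V)"
proof -
  obtain u where u: "u \<ge> 0" "entries_bounded u U" using ex_entries_bounded by blast
  obtain v where v: "v \<ge> 0" "entries_bounded v V" using ex_entries_bounded by blast
  have "entries_bounded (real n * (real n * (u * r) * v)) (U * P * V)"
    if P: "P \<in> carrier_mat n n" and "entries_bounded r P" for P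
  proof (rule entries_bounded_mult[OF _ V _ v(2)])
    show "entries_bounded (real n * (u * r)) (U * P)"
      using that u by (intro entries_bounded_mult[OF U P]) auto
  qed (use U P u r in auto)
  then show ?thesis by blast
qed

lemma entries_bounded_smult:
  assumes "entries_bounded c X" "t \<ge> 0"
  shows "entries_bounded (t * c) (t \<cdot>\<^sub>m X)"
proof -
  have X: "X \<in> carrier_mat (dim_row X) (dim_col X)" by auto
  then have tX: "t \<cdot>\<^sub>m X \<in> carrier_mat (dim_row X) (dim_col X)" by auto
  show ?thesis
    using assms unfolding entries_bounded_iff[OF X] entries_bounded_iff[OF tX]
    by (auto simp: abs_mult intro: mult_left_mono)
qed

subsection \<open>Feasible points\<close>

lemma transpose_smult: "(t \<cdot>\<^sub>m X)\<^sup>T = t \<cdot>\<^sub>m X\<^sup>T"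
  by (intro eq_matI) auto

lemma quadratic_form_smult:
  fixes X :: "real mat"
  assumes "X \<in> carrier_mat n n" "v \<in> carrier_vec n"
  shows "v \<bullet> ((t \<cdot>\<^sub>m X) *\<^sub>v v) = t * (v \<bullet> (X *\<^sub>v v))"
proof -
  have "(t \<cdot>\<^sub>m X) *\<^sub>v v = t \<cdot>\<^sub>v (X *\<^sub>v v)"
    using assms by (intro eq_vecI) auto
  then show ?thesis using assms by simp
qed

text \<open>The definiteness predicates carry no explicit dimension; squareness is recovered from
  the symmetry they contain.\<close>

lemma square_of_transpose_eq:
  assumes "X\<^sup>T = X" shows "X \<in> carrier_mat (dim_row X) (dim_row X)"
proof -
  have "dim_row X\<^sup>T = dim_row X" using assms by simp
  then have "dim_col X = dim_row X" by simp
  then show ?thesis by (intro carrier_matI) simp_all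
qed

lemma neg_def_smult:
  assumes "neg_def X" "t > 0" shows "neg_def (t \<cdot>\<^sub>m X)"
proof -
  have "X\<^sup>T = X" using assms by (simp add: neg_def_def)
  then have X: "X \<in> carrier_mat (dim_row X) (dim_row X)" by (rule square_of_transpose_eq)
  show ?thesis
    using assms quadratic_form_smult[OF X] by (auto simp: neg_def_def transpose_smult mult_less_0_iff)
qed

lemma pos_def_smult:
  assumes "pos_def X" "t > 0" shows "pos_def (t \<cdot>\<^sub>m X)"
proof -
  have "X\<^sup>T = X" using assms by (simp add: pos_def_def)
  then have X: "X \<in> carrier_mat (dim_row X) (dim_row X)" by (rule square_of_transpose_eq)
  show ?thesis
    using assms quadratic_form_smult[OF X] by (auto simp: pos_def_def transpose_smult)
qed

text \<open>Diagonal matrices are symmetric, so transposing \<open>S * N * G\<close> reverses the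
  factors without changing \<open>S\<close> and \<open>G\<close>. This identifies the closed-loop
  terms of both problems under \<open>\<Theta> = S * N * G\<close>.\<close>

lemma closed_loop_term_eq:
  assumes B: "B \<in> carrier_mat nx nu" and C: "C \<in> carrier_mat ny nx" and N: "N \<in> carrier_mat nu ny"
    and S: "selection nu S" and G: "selection ny G"
  shows "B * S * N * G * C = B * (S * N * G) * C"
    and "C\<^sup>T * G * N\<^sup>T * S * B\<^sup>T = C\<^sup>T * (S * N * G)\<^sup>T * B\<^sup>T"
proof -
  have carrier: "S \<in> carrier_mat nu nu" "G \<in> carrier_mat ny ny"
    and tr: "S\<^sup>T = S" "G\<^sup>T = G"
    using S G by (auto simp: selection_def intro: transpose_diagonal)
  have "B * S * N * G = B * (S * N) * G"
    using assoc_mult_mat[OF B carrier(1) N] by simp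
  also have "\<dots> = B * (S * N * G)"
    using B carrier N by (intro assoc_mult_mat) auto
  finally show "B * S * N * G * C = B * (S * N * G) * C" by simp
  have SN: "S * N \<in> carrier_mat nu ny" using carrier N by auto
  have "(S * N * G)\<^sup>T = G * (N\<^sup>T * S)"
    using transpose_mult[OF SN carrier(2)] transpose_mult[OF carrier(1) N] tr by simp
  moreover have "C\<^sup>T * (G * (N\<^sup>T * S)) = C\<^sup>T * G * (N\<^sup>T * S)"
    using C carrier N by (intro assoc_mult_mat[symmetric]) auto
  moreover have "\<dots> = C\<^sup>T * G * N\<^sup>T * S"
    using C carrier N by (intro assoc_mult_mat[symmetric]) auto
  ultimately show "C\<^sup>T * G * N\<^sup>T * S * B\<^sup>T = C\<^sup>T * (S * N * G)\<^sup>T * B\<^sup>T" by simp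
qed

text \<open>The expression is linear in the pair of \<open>P\<close> and \<open>\<Theta>\<close>, so
  scaling both by a positive factor preserves its definiteness.\<close>

lemma lyapunov_smult:
  fixes A B C P \<Theta> :: "real mat"
  assumes A: "A \<in> carrier_mat nx nx" and B: "B \<in> carrier_mat nx nu" and C: "C \<in> carrier_mat ny nx"
    and P: "P \<in> carrier_mat nx nx" and \<Theta>: "\<Theta> \<in> carrier_mat nu ny"
  shows "A\<^sup>T * (t \<cdot>\<^sub>m P) + t \<cdot>\<^sub>m P * A + C\<^sup>T * (t \<cdot>\<^sub>m \<Theta>)\<^sup>T * B\<^sup>T + B * (t \<cdot>\<^sub>m \<Theta>) * C =
    t \<cdot>\<^sub>m (A\<^sup>T * P + P * A + C\<^sup>T * \<Theta>\<^sup>T * B\<^sup>T + B * \<Theta> * C)"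
proof -
  have X: "A\<^sup>T * P \<in> carrier_mat nx nx" "P * A \<in> carrier_mat nx nx"
    "C\<^sup>T * \<Theta>\<^sup>T * B\<^sup>T \<in> carrier_mat nx nx" "B * \<Theta> * C \<in> carrier_mat nx nx"
    using A B C P \<Theta> by auto
  have "A\<^sup>T * (t \<cdot>\<^sub>m P) = t \<cdot>\<^sub>m (A\<^sup>T * P)" using A P by (intro mult_smult_distrib) auto
  moreover have "t \<cdot>\<^sub>m P * A = t \<cdot>\<^sub>m (P * A)" using A P by (intro mult_smult_assoc_mat) auto
  moreover have "C\<^sup>T * (t \<cdot>\<^sub>m \<Theta>)\<^sup>T * B\<^sup>T = t \<cdot>\<^sub>m (C\<^sup>T * \<Theta>\<^sup>T * B\<^sup>T)"
  proof -
    have "C\<^sup>T * (t \<cdot>\<^sub>m \<Theta>)\<^sup>T = t \<cdot>\<^sub>m (C\<^sup>T * \<Theta>\<^sup>T)"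
      unfolding transpose_smult using C \<Theta> by (intro mult_smult_distrib) auto
    then show ?thesis
      using B C \<Theta> by (simp add: mult_smult_assoc_mat[of _ nx nu _ nx])
  qed
  moreover have "B * (t \<cdot>\<^sub>m \<Theta>) * C = t \<cdot>\<^sub>m (B * \<Theta> * C)"
    using B C \<Theta> by (simp add: mult_smult_distrib[OF B \<Theta>] mult_smult_assoc_mat[of _ nx ny _ nx])
  moreover note add_smult_distrib_left_mat[OF X(1,2)]
    add_smult_distrib_left_mat[OF add_carrier_mat[OF X(2)] X(3)]
    add_smult_distrib_left_mat[OF add_carrier_mat[OF X(3)] X(4)]
  ultimately show ?thesis by simp
qed

text \<open>Brings the first problem into the form of the second, with the product in place of
  \<open>\<Theta>\<close> and the structured constraint split in two. What separates the problems is
  then only the step from equations to big-M bounds.\<close>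

lemma ssasp_feasible_iff:
  assumes A: "A \<in> carrier_mat nx nx"
    and B: "B \<in> carrier_mat nx (\<Sum>i<n. du i)" and C: "C \<in> carrier_mat (\<Sum>i<n. dy i) nx"
    and rank: "full_col_rank B"
  shows "(\<pi>, \<gamma>, N, M, P) \<in> ssasp_feasible n du dy A B C \<Phi> \<phi> \<longleftrightarrow>
    binary_vec n \<pi> \<and> binary_vec n \<gamma> \<and>
    N \<in> carrier_mat (\<Sum>i<n. du i) (\<Sum>i<n. dy i) \<and>
    M \<in> carrier_mat (\<Sum>i<n. du i) (\<Sum>i<n. du i) \<and>
    P \<in> carrier_mat nx nx \<and> P\<^sup>T = P \<and>
    (let S = selection_mat du \<pi>; G = selection_mat dy \<gamma>; \<Theta> = S * N * G in
      neg_def (A\<^sup>T * P + P * A + C\<^sup>T * \<Theta>\<^sup>T * B\<^sup>T + B * \<Theta> * C) \<and>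
      Omega B P * S = S * M \<and> Xi B P * S = 0\<^sub>m nx (\<Sum>i<n. du i)) \<and>
    pos_def P \<and> \<Phi> *\<^sub>v (\<pi> @\<^sub>v \<gamma>) \<le> \<phi>"
proof -
  have "(let S = selection_mat du \<pi>; G = selection_mat dy \<gamma> in
        neg_def (A\<^sup>T * P + P * A + C\<^sup>T * G * N\<^sup>T * S * B\<^sup>T + B * S * N * G * C) \<and>
        B * S * M = P * B * S) \<longleftrightarrow>
    (let S = selection_mat du \<pi>; G = selection_mat dy \<gamma>; \<Theta> = S * N * G in
      neg_def (A\<^sup>T * P + P * A + C\<^sup>T * \<Theta>\<^sup>T * B\<^sup>T + B * \<Theta> * C) \<and>
      Omega B P * S = S * M \<and> Xi B P * S = 0\<^sub>m nx (\<Sum>i<n. du i))"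
    if "binary_vec n \<pi>" "binary_vec n \<gamma>" and N: "N \<in> carrier_mat (\<Sum>i<n. du i) (\<Sum>i<n. dy i)"
      and M: "M \<in> carrier_mat (\<Sum>i<n. du i) (\<Sum>i<n. du i)" and P: "P \<in> carrier_mat nx nx"
  proof -
    have S: "selection (\<Sum>i<n. du i) (selection_mat du \<pi>)"
      and G: "selection (\<Sum>i<n. dy i) (selection_mat dy \<gamma>)"
      using that by (auto intro: selection_selection_mat)
    then have "selection_mat du \<pi> \<in> carrier_mat (\<Sum>i<n. du i) (\<Sum>i<n. du i)"
      by (simp add: selection_def)
    from structured_constraint_iff[OF B rank P this M] closed_loop_term_eq[OF B C N S G]
    show ?thesis unfolding Let_def by simp
  qed
  moreover have "dim_row A = nx" "dim_col B = (\<Sum>i<n. du i)" "dim_row C = (\<Sum>i<n. dy i)"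
    using A B C by auto
  ultimately show ?thesis unfolding ssasp_feasible_def mem_Collect_eq case_prod_conv by (metis (no_types, lifting))
qed

text \<open>All constraints on the continuous variables are homogeneous, and the selections stay
  fixed. This allows shrinking an arbitrary feasible point until given big-M constants dominate
  it.\<close>

lemma ssasp_feasible_smult:
  assumes A: "A \<in> carrier_mat nx nx"
    and B: "B \<in> carrier_mat nx (\<Sum>i<n. du i)" and C: "C \<in> carrier_mat (\<Sum>i<n. dy i) nx"
    and rank: "full_col_rank B" and t: "t > 0"
    and feas: "(\<pi>, \<gamma>, N, M, P) \<in> ssasp_feasible n du dy A B C \<Phi> \<phi>"
  shows "(\<pi>, \<gamma>, t \<cdot>\<^sub>m N, t \<cdot>\<^sub>m M, t \<cdot>\<^sub>m P) \<in> ssasp_feasible n du dy A B C \<Phi> \<phi>"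
proof -
  let ?nu = "\<Sum>i<n. du i" and ?ny = "\<Sum>i<n. dy i"
  define S where "S = selection_mat du \<pi>"
  define G where "G = selection_mat dy \<gamma>"
  define \<Theta> where "\<Theta> = S * N * G"
  note F = feas[unfolded ssasp_feasible_iff[OF A B C rank] Let_def, folded S_def G_def, folded \<Theta>_def]
  have S: "S \<in> carrier_mat ?nu ?nu" and G: "G \<in> carrier_mat ?ny ?ny"
    using F selection_mat_carrier unfolding S_def G_def by blast+
  have N: "N \<in> carrier_mat ?nu ?ny" and M: "M \<in> carrier_mat ?nu ?nu" and P: "P \<in> carrier_mat nx nx"
    using F by auto
  have \<Theta>: "\<Theta> \<in> carrier_mat ?nu ?ny" using S G N by (simp add: \<Theta>_def)
  have "S * (t \<cdot>\<^sub>m N) * G = t \<cdot>\<^sub>m \<Theta>"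
    using S G N by (simp add: \<Theta>_def mult_smult_distrib[OF S N] mult_smult_assoc_mat[of _ ?nu ?ny _ ?ny])
  moreover have "B * S * (t \<cdot>\<^sub>m M) = t \<cdot>\<^sub>m P * B * S"
  proof -
    have "B * S * (t \<cdot>\<^sub>m M) = t \<cdot>\<^sub>m (B * S * M)"
      using B S M by (intro mult_smult_distrib) auto
    also have "B * S * M = P * B * S"
      using structured_constraint_iff[OF B rank P S M] F by blast
    also have "t \<cdot>\<^sub>m (P * B * S) = t \<cdot>\<^sub>m P * B * S"
      using B S P by (simp add: mult_smult_assoc_mat[OF P B] mult_smult_assoc_mat[of _ nx ?nu _ ?nu])
    finally show ?thesis .
  qed
  \<comment> \<open>Homogeneity is checked on the unsplit constraint just proved; splitting it again
    avoids computing \<open>Omega\<close> and \<open>Xi\<close> at the scaled matrix.\<close>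
  moreover have "Omega B (t \<cdot>\<^sub>m P) * S = S * (t \<cdot>\<^sub>m M) \<and> Xi B (t \<cdot>\<^sub>m P) * S = 0\<^sub>m nx ?nu"
    using structured_constraint_iff[OF B rank _ S, of "t \<cdot>\<^sub>m P" "t \<cdot>\<^sub>m M"] calculation P M by simp
  moreover have "neg_def (A\<^sup>T * (t \<cdot>\<^sub>m P) + t \<cdot>\<^sub>m P * A +
      C\<^sup>T * (t \<cdot>\<^sub>m \<Theta>)\<^sup>T * B\<^sup>T + B * (t \<cdot>\<^sub>m \<Theta>) * C)"
    unfolding lyapunov_smult[OF A B C P \<Theta>] using F neg_def_smult[OF _ t] by blast
  ultimately show ?thesis
    unfolding ssasp_feasible_iff[OF A B C rank] Let_def S_def[symmetric] G_def[symmetric]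
    using F P N M pos_def_smult[OF _ t, of P] transpose_smult[of t P]
    by (simp del: transpose_mult assoc_mult_mat assoc_add_mat)
qed

lemma ssasp_feasible_if_bigM_feasible:
  assumes A: "A \<in> carrier_mat nx nx"
    and B: "B \<in> carrier_mat nx (\<Sum>i<n. du i)" and C: "C \<in> carrier_mat (\<Sum>i<n. dy i) nx"
    and rank: "full_col_rank B"
    and feas: "(\<pi>, \<gamma>, N, M, P, \<Theta>) \<in> bigM_feasible n du dy A B C \<Phi> \<phi> L1 L2 L3"
  shows "(\<pi>, \<gamma>, N, M, P) \<in> ssasp_feasible n du dy A B C \<Phi> \<phi>"
proof -
  let ?nu = "\<Sum>i<n. du i" and ?ny = "\<Sum>i<n. dy i"
  have dims: "dim_row A = nx" "dim_col B = ?nu" "dim_row C = ?ny" using A B C by auto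
  note F = feas[unfolded bigM_feasible_def mem_Collect_eq case_prod_conv Let_def dims]
  have S: "selection ?nu (selection_mat du \<pi>)" and G: "selection ?ny (selection_mat dy \<gamma>)"
    using F by (auto intro: selection_selection_mat)
  have P: "P \<in> carrier_mat nx nx" using F by blast
  note W = Omega_carrier[OF B rank P]
  have "\<Theta> = selection_mat du \<pi> * N * selection_mat dy \<gamma>"
    using F by (intro Psi1_leD[OF S G]) auto
  moreover have "Omega B P * selection_mat du \<pi> = selection_mat du \<pi> * M"
    using F by (intro Psi2_leD[OF S _ W]) auto
  moreover have "Xi B P * selection_mat du \<pi> = 0\<^sub>m nx ?nu"
    using F by (intro Psi3_leD[OF S Xi_carrier[OF B P]]) auto
  ultimately show ?thesis
    unfolding ssasp_feasible_iff[OF A B C rank] Let_def using F by blast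
qed

text \<open>The witness for \<open>\<Theta>\<close> is the selected part of \<open>N\<close>, the
  only value that the first big-M constraint admits. \<open>L2\<close> has to dominate two matrices
  because \<open>Psi2\<close> contains both \<open>M\<close> and \<open>Omega B P\<close>.\<close>

lemma bigM_feasible_if_ssasp_feasible:
  assumes A: "A \<in> carrier_mat nx nx"
    and B: "B \<in> carrier_mat nx (\<Sum>i<n. du i)" and C: "C \<in> carrier_mat (\<Sum>i<n. dy i) nx"
    and rank: "full_col_rank B"
    and feas: "(\<pi>, \<gamma>, N, M, P) \<in> ssasp_feasible n du dy A B C \<Phi> \<phi>"
    and bd: "entries_bounded L1 N" "entries_bounded L2 M" "entries_bounded L2 (Omega B P)"
      "entries_bounded L3 (Xi B P)"
  shows "(\<pi>, \<gamma>, N, M, P, selection_mat du \<pi> * N * selection_mat dy \<gamma>)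
    \<in> bigM_feasible n du dy A B C \<Phi> \<phi> L1 L2 L3"
proof -
  let ?nu = "\<Sum>i<n. du i" and ?ny = "\<Sum>i<n. dy i"
  have dims: "dim_row A = nx" "dim_col B = ?nu" "dim_row C = ?ny" using A B C by auto
  note F = feas[unfolded ssasp_feasible_iff[OF A B C rank] Let_def]
  have S: "selection ?nu (selection_mat du \<pi>)" and G: "selection ?ny (selection_mat dy \<gamma>)"
    using F by (auto intro: selection_selection_mat)
  have P: "P \<in> carrier_mat nx nx" and N: "N \<in> carrier_mat ?nu ?ny" and M: "M \<in> carrier_mat ?nu ?nu"
    using F by blast+
  have eq: "Omega B P * selection_mat du \<pi> = selection_mat du \<pi> * M"
    "Xi B P * selection_mat du \<pi> = 0\<^sub>m nx ?nu" using F by blast+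
  have \<Theta>: "selection_mat du \<pi> * N * selection_mat dy \<gamma> \<in> carrier_mat ?nu ?ny"
    using S G N by (auto simp: selection_def)
  show ?thesis
    unfolding bigM_feasible_def mem_Collect_eq case_prod_conv Let_def dims
    using F \<Theta> Psi1_leI[OF S G N bd(1)] Psi2_leI[OF S M Omega_carrier[OF B rank P] eq(1) bd(2,3)]
      Psi3_leI[OF S Xi_carrier[OF B P] eq(2) bd(4)] by blast
qed

section \<open>Equivalence of problems whose costs depend on the selections only\<close>

lemma equivalent_problemsI:
  assumes f: "\<And>\<pi> \<gamma> N M P. f (\<pi>, \<gamma>, N, M, P) = c \<pi> \<gamma>"
    and g: "\<And>\<pi> \<gamma> N M P \<Theta>. g (\<pi>, \<gamma>, N, M, P, \<Theta>) = c \<pi> \<gamma>"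
    and proj: "\<And>\<pi> \<gamma> N M P \<Theta>. (\<pi>, \<gamma>, N, M, P, \<Theta>) \<in> G \<Longrightarrow> (\<pi>, \<gamma>, N, M, P) \<in> F"
    and lift: "\<And>\<pi> \<gamma> N M P. (\<pi>, \<gamma>, N, M, P) \<in> F \<Longrightarrow> \<exists>N' M' P' \<Theta>. (\<pi>, \<gamma>, N', M', P', \<Theta>) \<in> G"
    and bounded_lift: "\<And>\<pi> \<gamma> N M P. (\<pi>, \<gamma>, N, M, P) \<in> F \<Longrightarrow>
      entries_bounded R N \<Longrightarrow> entries_bounded R M \<Longrightarrow> entries_bounded R P \<Longrightarrow>
      \<exists>\<Theta>. (\<pi>, \<gamma>, N, M, P, \<Theta>) \<in> G"
  shows "equivalent_problems R f F g G"
proof -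
  \<comment> \<open>Projection and lifting keep the selections, on which alone the cost depends.
    Hence both problems attain the same set of cost values, which also yields equal infima if both
    are infeasible.\<close>
  have le_g: "\<exists>z\<in>F. f z = g w" if "w \<in> G" for w
    using that proj f g by (cases w) metis
  have le_f: "\<exists>w\<in>G. g w = f z" if "z \<in> F" for z
    using that lift f g by (cases z) metis
  have val: "optimal_value f F = optimal_value g G"
    unfolding optimal_value_def
  proof (rule INF_eq)
    show "\<exists>w\<in>G. ereal (g w) \<le> ereal (f z)" if "z \<in> F" for z
      using le_f[OF that] by (metis order_refl)
    show "\<exists>z\<in>F. ereal (f z) \<le> ereal (g w)" if "w \<in> G" for w
      using le_g[OF that] by (metis order_refl)
  qed
  have min_f: "is_minimizer f F z \<longleftrightarrow> z \<in> F \<and> (\<forall>y\<in>F. f z \<le> f y)" for z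
    by (auto simp: is_minimizer_def is_arg_min_def not_less)
  have min_g: "is_minimizer g G z \<longleftrightarrow> z \<in> G \<and> (\<forall>y\<in>G. g z \<le> g y)" for z
    by (auto simp: is_minimizer_def is_arg_min_def not_less)
  \<comment> \<open>Being a minimizer compares a cost only with the attained cost values, and these
    agree; so feasible points of equal cost are minimizers together.\<close>
  have min_fg: "is_minimizer f F z \<longleftrightarrow> is_minimizer g G w" if "z \<in> F" "w \<in> G" "f z = g w" for z w
    using that le_f le_g unfolding min_f min_g by metis
  have down: "is_minimizer f F (\<pi>, \<gamma>, N, M, P)" if "is_minimizer g G (\<pi>, \<gamma>, N, M, P, \<Theta>)" for \<pi> \<gamma> N M P \<Theta>
  proof -
    have w: "(\<pi>, \<gamma>, N, M, P, \<Theta>) \<in> G" using that by (simp add: min_g)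
    show ?thesis using min_fg[OF proj[OF w] w] f g that by simp
  qed
  have up: "is_minimizer g G (\<pi>, \<gamma>, N', M', P', \<Theta>)"
    if "is_minimizer f F (\<pi>, \<gamma>, N, M, P)" "(\<pi>, \<gamma>, N', M', P', \<Theta>) \<in> G" for \<pi> \<gamma> N M P N' M' P' \<Theta>
  proof -
    have "(\<pi>, \<gamma>, N, M, P) \<in> F" using that(1) by (simp add: min_f)
    from min_fg[OF this that(2)] that(1) f g show ?thesis by simp
  qed
  have inF: "(\<pi>, \<gamma>, N, M, P) \<in> F" if "is_minimizer f F (\<pi>, \<gamma>, N, M, P)" for \<pi> \<gamma> N M P
    using that by (simp add: min_f)
  show ?thesis
    unfolding equivalent_problems_def
  proof (intro conjI allI impI)
    fix \<pi> \<gamma> N M P assume z: "is_minimizer f F (\<pi>, \<gamma>, N, M, P)"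
    show "\<exists>N' M' P' \<Theta>. is_minimizer g G (\<pi>, \<gamma>, N', M', P', \<Theta>)"
      using lift[OF inF[OF z]] up[OF z] by blast
  next
    fix \<pi> \<gamma> N M P assume z: "is_minimizer f F (\<pi>, \<gamma>, N, M, P) \<and>
      entries_bounded R N \<and> entries_bounded R M \<and> entries_bounded R P"
    then show "\<exists>\<Theta>. is_minimizer g G (\<pi>, \<gamma>, N, M, P, \<Theta>)"
      using bounded_lift[OF inF] up by blast
  qed (use val proj lift bounded_lift down f g in simp_all)
qed

section \<open>Choice of the big-M threshold\<close>

theorem theorem1:
  fixes n m :: nat
    and dx du dy :: "nat \<Rightarrow> nat"
    and Bs Cs :: "nat \<Rightarrow> real mat"
    and A B C \<Phi> :: "real mat"
    and \<phi> :: "real vec"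
  assumes "A \<in> carrier_mat (\<Sum>i<n. dx i) (\<Sum>i<n. dx i)"
    and "\<And>i. i < n \<Longrightarrow> Bs i \<in> carrier_mat (dx i) (du i)"
    and "\<And>i. i < n \<Longrightarrow> Cs i \<in> carrier_mat (dy i) (dx i)"
    and "B = diag_block_mat (map Bs [0..<n])"
    and "C = diag_block_mat (map Cs [0..<n])"
    and "stabilizable A B" and "detectable A C"
    and "full_col_rank B" and "full_row_rank C"
    and "\<Phi> \<in> carrier_mat m (2 * n)" and "\<phi> \<in> carrier_vec m"
  shows "\<forall>R. \<exists>L0>0. \<forall>L1\<ge>L0. \<forall>L2\<ge>L0. \<forall>L3\<ge>L0.
    equivalent_problems R
      (ssasp_cost n) (ssasp_feasible n du dy A B C \<Phi> \<phi>)
      (bigM_cost n) (bigM_feasible n du dy A B C \<Phi> \<phi> L1 L2 L3)"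
proof
  fix R :: real
  let ?nx = "\<Sum>i<n. dx i" and ?nu = "\<Sum>i<n. du i" and ?ny = "\<Sum>i<n. dy i"
  let ?F = "ssasp_feasible n du dy A B C \<Phi> \<phi>"
  note A = assms(1) and rank = assms(8)
  have B: "B \<in> carrier_mat ?nx ?nu" and C: "C \<in> carrier_mat ?ny ?nx"
    using assms(2-5) by (auto intro: diag_block_mat_carrier)
  \<comment> \<open>The lower bound \<open>R\<close> covers the given bounded points, and the lower
    bound 1 covers points scaled to entries of size at most 1. It also handles negative
    \<open>R\<close>.\<close>
  define r where "r = max 1 R"
  have r: "r \<ge> 0" "1 \<le> r" "R \<le> r" by (auto simp: r_def)
  have U: "the (mat_inverse (B\<^sup>T * B)) * B\<^sup>T \<in> carrier_mat ?nu ?nx"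
    "1\<^sub>m (dim_row B) - B * the (mat_inverse (B\<^sup>T * B)) * B\<^sup>T \<in> carrier_mat ?nx ?nx"
    using B full_col_rank_left_inverse(1)[OF B rank] by auto
  obtain a where a: "\<And>P. P \<in> carrier_mat ?nx ?nx \<Longrightarrow> entries_bounded r P \<Longrightarrow> entries_bounded a (Omega B P)"
    using ex_entries_bounded_sandwich[OF U(1) B r(1)] unfolding Omega_def by blast
  obtain b where b: "\<And>P. P \<in> carrier_mat ?nx ?nx \<Longrightarrow> entries_bounded r P \<Longrightarrow> entries_bounded b (Xi B P)"
    using ex_entries_bounded_sandwich[OF U(2) B r(1)] unfolding Xi_def by blast
  \<comment> \<open>For entries bounded by \<open>r\<close>, the three terms dominate
    \<open>N\<close> and \<open>M\<close>, \<open>Omega B P\<close>, and \<open>Xi B P\<close>,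
    respectively.\<close>
  define L0 where "L0 = max r (max a b)"
  have "equivalent_problems R (ssasp_cost n) ?F
      (bigM_cost n) (bigM_feasible n du dy A B C \<Phi> \<phi> L1 L2 L3)"
    if L: "L0 \<le> L1" "L0 \<le> L2" "L0 \<le> L3" for L1 L2 L3
  proof (rule equivalent_problemsI[where c = "\<lambda>\<pi> \<gamma>. \<Sum>k<n. \<pi> $ k + \<gamma> $ k"])
    fix \<pi> \<gamma> N M P \<Theta> assume "(\<pi>, \<gamma>, N, M, P, \<Theta>) \<in> bigM_feasible n du dy A B C \<Phi> \<phi> L1 L2 L3"
    then show "(\<pi>, \<gamma>, N, M, P) \<in> ?F" by (rule ssasp_feasible_if_bigM_feasible[OF A B C rank])
  next
    \<comment> \<open>Lifting for the radius \<open>r\<close> serves both remaining goals: directly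
      for points bounded by \<open>R\<close>, and after scaling for arbitrary ones.\<close>
    have *: "\<exists>\<Theta>. (\<pi>, \<gamma>, N, M, P, \<Theta>) \<in> bigM_feasible n du dy A B C \<Phi> \<phi> L1 L2 L3"
      if z: "(\<pi>, \<gamma>, N, M, P) \<in> ?F"
        and bd: "entries_bounded r N" "entries_bounded r M" "entries_bounded r P" for \<pi> \<gamma> N M P
    proof -
      have P: "P \<in> carrier_mat ?nx ?nx" using z unfolding ssasp_feasible_iff[OF A B C rank] by blast
      have "r \<le> L1" "r \<le> L2" "a \<le> L2" "b \<le> L3" using L by (auto simp: L0_def)
      then show ?thesis
        using bigM_feasible_if_ssasp_feasible[OF A B C rank z] bd a[OF P bd(3)] b[OF P bd(3)]
          entries_bounded_mono by blast
    qed
    fix \<pi> \<gamma> N M P assume z: "(\<pi>, \<gamma>, N, M, P) \<in> ?F"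
    show "\<exists>\<Theta>. (\<pi>, \<gamma>, N, M, P, \<Theta>) \<in> bigM_feasible n du dy A B C \<Phi> \<phi> L1 L2 L3"
      if "entries_bounded R N" "entries_bounded R M" "entries_bounded R P"
      using *[OF z] that entries_bounded_mono[OF _ r(3)] by blast
    obtain x y w where xyw: "x \<ge> 0" "entries_bounded x N" "y \<ge> 0" "entries_bounded y M"
      "w \<ge> 0" "entries_bounded w P" using ex_entries_bounded by metis
    \<comment> \<open>The sum exceeds each of the three bounds and is positive even if they are all
      0, so division by \<open>s\<close> brings all entries to absolute value at most 1.\<close>
    define s where "s = 1 + x + y + w"
    have s: "s > 0" "x \<le> s" "y \<le> s" "w \<le> s" using xyw by (auto simp: s_def)
    have scaled: "entries_bounded r ((1 / s) \<cdot>\<^sub>m X)" if "entries_bounded v X" "v \<le> s" for v X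
    proof -
      have "entries_bounded (1 / s * s) ((1 / s) \<cdot>\<^sub>m X)"
        using that s(1) by (intro entries_bounded_smult) (auto intro: entries_bounded_mono)
      then show ?thesis using s(1) r(2) by (auto intro: entries_bounded_mono)
    qed
    have "(\<pi>, \<gamma>, (1 / s) \<cdot>\<^sub>m N, (1 / s) \<cdot>\<^sub>m M, (1 / s) \<cdot>\<^sub>m P) \<in> ?F"
      using s(1) by (intro ssasp_feasible_smult[OF A B C rank _ z]) simp
    then show "\<exists>N' M' P' \<Theta>. (\<pi>, \<gamma>, N', M', P', \<Theta>) \<in> bigM_feasible n du dy A B C \<Phi> \<phi> L1 L2 L3"
      using *[OF _ scaled scaled scaled] xyw s by blast
  qed simp_all
  moreover have "L0 > 0" using r by (auto simp: L0_def)
  ultimately show "\<exists>L0>0. \<forall>L1\<ge>L0. \<forall>L2\<ge>L0. \<forall>L3\<ge>L0.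
    equivalent_problems R (ssasp_cost n) ?F
      (bigM_cost n) (bigM_feasible n du dy A B C \<Phi> \<phi> L1 L2 L3)"
    by blast
qed

end
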